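(* Consider the closed-loop network system (agents, disturbances and multiplex control protocol) described in the context, with outputs $y_i(t)=x_i(t)$, and let $1\le p\le\infty$. Let $x^\ast(t)=[x_1^{\ast\mathsf T}(t),\ldots,x_N^{\ast\mathsf T}(t)]^{\mathsf T}$ be the desired solution. Let $\alpha_1,\ldots,\alpha_m\in\mathbb{R}$ be constants independent of $N$ and let $\bar T\in\mathbb{R}^{n(m+1)\times n(m+1)}$ be the block upper bidiagonal matrix (blocks of size $n\times n$) with all diagonal blocks equal to $I_n$, with $(k,k+1)$ block equal to $\alpha_k I_n$ for $k=1,\ldots,m$, and all other blocks equal to zero. Suppose that, for some constants $0\le\underline\sigma<\bar\sigma<+\infty$ (independent of $N$), the following conditions hold for all $t\ge t_0$ and for every $N$: (C1) for all $i\in\{1,\ldots,N\}$ and all $k\in\{0,\ldots,m\}$, the couplings vanish along the desired solution: $$h_{i,k}\big(x_i^\ast,\{x_j^\ast\}_{j\in\mathcal N_i},x_l,t\big)=0,\qquad h^{(\tau)}_{i,k}\big(x_i^\ast,\{x_j^\ast\}_{j\in\mathcal N_i},x_l,t\big)=0,$$ where the state and leader arguments of $h_{i,k}$ are evaluated at time $t$ and those of $h_{i,k}^{(\tau)}$ are evaluated at time $t-\tau(t)$; (C2) $\mu_p\big(\bar T\bar A_{ii}(t)\bar T^{-1}\big)+\sum_{j\neq i}\big\|\bar T\bar A_{ij}(t)\bar T^{-1}\big\|_p\le-\bar\sigma$ for all $i$, all $x\in\mathbb{R}^{nN}$ and all $x_l\in\mathbb{R}^{nM}$; (C3) $\sum_{j}\big\|\bar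 T\bar B_{ij}(t)\bar T^{-1}\big\|_p\le\underline\sigma$ for all $i$, all $x\in\mathbb{R}^{nN}$ and all $x_l\in\mathbb{R}^{nM}$ (the sum includes $j=i$). Here $\bar A_{ii}(t),\bar A_{ij}(t),\bar B_{ij}(t)\in\mathbb{R}^{n(m+1)\times n(m+1)}$ (dependence on $x,x_l$ omitted) are $$\bar A_{ii}(t)=\begin{bmatrix}\frac{\partial f_i(x_i,t)}{\partial x_i}+\frac{\partial h_{i,0}(x,x_l,t)}{\partial x_i}&I_n&0_n&\cdots&0_n\\ \frac{\partial h_{i,1}(x,x_l,t)}{\partial x_i}&0_n&I_n&\cdots&0_n\\ \vdots&\vdots&\vdots&\ddots&\vdots\\ \frac{\partial h_{i,m-1}(x,x_l,t)}{\partial x_i}&0_n&0_n&\cdots&I_n\\ \frac{\partial h_{i,m}(x,x_l,t)}{\partial x_i}&0_n&0_n&\cdots&0_n\end{bmatrix},$$ $$\bar A_{ij}(t)=\begin{bmatrix}\frac{\partial h_{i,0}(x,x_l,t)}{\partial x_j}&0_n&\cdots&0_n\\ \vdots&\vdots&\ddots&\vdots\\ \frac{\partial h_{i,m}(x,x_l,t)}{\partial x_j}&0_n&\cdots&0_n\end{bmatrix}\ (j\ne i),\qquad \bar B_{ij}(t)=\begin{bmatrix}\frac{\partial h^{(\tau)}_{i,0}(x,x_l,t)}{\partial x_j}&0_n&\cdots&0_n\\ \vdots&\vdots&\ddots&\vdots\\ \frac{\partial h^{(\tau)}_{i,m}(x,x_l,t)}{\partial x_j}&0_n&\cdots&0_n\end{bmatrix}.$$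 Then the system is $\mathcal{L}_\infty^p$-Input-to-State Scalable with respect to $w(t)$. In particular, for any initial condition and all $t\ge t_0$, $$\max_i|x_i(t)-x_i^\ast(t)|_p\le\frac{\kappa_p(\bar T)}{\bar\sigma-\underline\sigma}\max_i\|w_i(\cdot)\|_{\mathcal{L}_\infty^p}+\kappa_p(\bar T)e^{-\lambda(t-t_0)}\Bigg(\max_i\sup_{t_0-\tau_{\max}\le s\le t_0}|x_i(s)-x_i^\ast(s)|_p$$ $$+\max_i\sup_{t_0-\tau_{\max}\le s\le t_0}\sum_{k=1}^m\Big|r_{i,k}(s)+\sum_{b=0}^{m-k}\frac{(m-1-b)!}{(m-k-b)!}\,\bar d_{i,m-1-b}\,s^{m-k-b}\Big|_p\Bigg)\quad\text{for every }N,$$ where $\kappa_p(\bar T):=\|\bar T\|_p\|\bar T^{-1}\|_p$ and $\lambda>0$ is the solution of $\lambda-\bar\sigma+\underline\sigma e^{\lambda\tau_{\max}}=0$.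
   Context: Norms. $|\cdot|_p$ is the $p$-vector norm, $\|\cdot\|_p$ the induced matrix norm, $\mu_p(A):=\lim_{h\to0^+}\frac{\|I+hA\|_p-1}{h}$ the induced matrix measure. For a piecewise continuous signal $w_i$, $\|w_i(\cdot)\|_{\mathcal{L}_\infty^p}:=\sup_t|w_i(t)|_p$. $I_n$ and $0_n$ are the $n\times n$ identity and zero matrices. Network. We consider networks of $N>1$ agents, for every $N$ ($n,m,p,\tau_{\max}$ are fixed, with $m\ge1$; the other data may depend on $N$). Agent $i\in\{1,\ldots,N\}$ has dynamics $$\dot x_i(t)=f_i(x_i,t)+u_i(t)+d_i(t),\quad t\ge t_0\ge0,\qquad y_i(t)=g_i(x_i),$$ with $x_i(t),u_i(t),d_i(t)\in\mathbb{R}^n$, $f_i:\mathbb{R}^n\times\mathbb{R}_{\ge0}\to\mathbb{R}^n$ smooth, $g_i:\mathbb{R}^n\to\mathbb{R}^q$. The disturbance is $d_i(t)=w_i(t)+\bar d_i(t)$ with $\bar d_i(t):=\sum_{k=0}^{m-1}\bar d_{i,k}t^k$, where $w_i$ is piecewise continuous and the $\bar d_{i,k}\in\mathbb{R}^n$ are constant vectors; $w(t)$ is the stack of the $w_i(t)$. Multiplex control protocol (with $m$ layers): $$u_i(t)=h_{i,0}(x_i,\{x_j\}_{j\in\mathcal N_i},x_l,t)+h^{(\tau)}_{i,0}(x_i,\{x_j\}_{j\in\mathcal N_i},x_l,t)+r_{i,1}(t),$$ $$\dot r_{i,k}(t)=h_{i,k}(x_i,\{x_j\}_{j\in\mathcal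 N_i},x_l,t)+h^{(\tau)}_{i,k}(x_i,\{x_j\}_{j\in\mathcal N_i},x_l,t)+r_{i,k+1}(t),\quad k=1,\ldots,m-1,$$ $$\dot r_{i,m}(t)=h_{i,m}(x_i,\{x_j\}_{j\in\mathcal N_i},x_l,t)+h^{(\tau)}_{i,m}(x_i,\{x_j\}_{j\in\mathcal N_i},x_l,t).$$ Here $\mathcal N_i$ is the set of neighbours of agent $i$, with $N_i:=|\mathcal N_i|\le\bar N<\infty$ for all $i$ and all $N$; $x_l(t)\in\mathbb{R}^{nM}$ is a reference signal (possibly from $M$ leaders); $h_{i,k},h^{(\tau)}_{i,k}:\mathbb{R}^n\times\mathbb{R}^{nN_i}\times\mathbb{R}^{nM}\times\mathbb{R}_{\ge0}\to\mathbb{R}^n$ are smooth. The functions $h_{i,k}$ are the delay-free couplings (state and leader arguments evaluated at time $t$); the functions $h_{i,k}^{(\tau)}$ are the delayed couplings (state and leader arguments evaluated at time $t-\tau(t)$), where the time-varying delay satisfies $0\le\tau(t)\le\tau_{\max}<\infty$ and is the same for all agents. With $x=[x_1^{\mathsf T},\ldots,x_N^{\mathsf T}]^{\mathsf T}$, one writes $h_{i,k}(x,x_l,t)$ and $h^{(\tau)}_{i,k}(x,x_l,t)$ for these functions viewed as functions of $x$ (derivatives with respect to non-neighbours' states are zero). Initial conditions: $x_i(s)=\varphi_i(s)$, $r_{i,k}(s)=\phi_{i,k}(s)$ for $s\in[t_0-\tau_{\max},t_0]$, with $\varphi_i,\phi_{i,k}$ continuous and bounded. Desired solution. $x^\ast(t)$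 is such that $\dot x_i^\ast(t)=f_i(x_i^\ast(t),t)$ with $x_i^\ast(s)=x_i^\ast(t_0)$ for $s\in[t_0-\tau_{\max},t_0]$, together with $r_{i,k}^\ast(t)=0$ for all $i,k,t$. Scalability. A continuous $\alpha:[0,a)\to[0,\infty)$ is of class $\mathcal K$ if strictly increasing with $\alpha(0)=0$; a continuous $\beta:[0,a)\times[0,\infty)\to[0,\infty)$ is of class $\mathcal{KL}$ if $\beta(\cdot,s)$ is of class $\mathcal K$ for each $s$ and, for each $r$, $\beta(r,\cdot)$ is decreasing with $\beta(r,s)\to0$ as $s\to\infty$. The closed-loop system is $\mathcal{L}_\infty^p$-Input-to-State Scalable with respect to $w(t)$ if there exist class $\mathcal{KL}$ functions $\alpha,\beta$ and a class $\mathcal K$ function $\gamma$ (none depending on $N$) such that for any initial condition and all $t\ge t_0$ $$\max_i|x_i(t)-x_i^\ast(t)|_p\le\gamma\Big(\max_i\|w_i(\cdot)\|_{\mathcal{L}_\infty^p}\Big)+\alpha\Big(\max_i\sup_{t_0-\tau_{\max}\le s\le t_0}|x_i(s)-x_i^\ast(s)|_p,\,t-t_0\Big)+\beta\Big(\max_i\sup_{t_0-\tau_{\max}\le s\le t_0}\sum_{k=1}^m\big|r_{i,k}(s)+\bar d_i^{(k-1)}(s)\big|_p,\,t-t_0\Big)$$ holds for every $N$, where $\bar d_i^{(k-1)}$ is the $(k-1)$-th derivative of $\bar d_i$. *)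

theory Defs
  imports "HOL-Analysis.Analysis"
begin

section \<open>Vector norms, induced matrix norms and matrix measures\<close>

definition pnorm :: "ereal \<Rightarrow> 'i set \<Rightarrow> ('i \<Rightarrow> real) \<Rightarrow> real" where
  "pnorm p I v =
    (if p = \<infinity> then MAX i\<in>I. \<bar>v i\<bar>
     else (\<Sum>i\<in>I. \<bar>v i\<bar> powr real_of_ereal p) powr (1 / real_of_ereal p))"

definition vnorm :: "ereal \<Rightarrow> real^'n \<Rightarrow> real" where
  "vnorm p v = pnorm p UNIV (\<lambda>a. v $ a)"

text \<open>
  A vector of size \<open>n(m+1)\<close> is given by its blocks \<open>v 0, \<dots>, v m\<close>, and a square matrix of
  that size by its \<open>n \<times> n\<close> blocks \<open>A a b\<close> with \<open>a, b \<le> m\<close>; blocks with a larger index are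
  irrelevant.  Block indices start at 0, so block \<open>(a, b)\<close> sits in block row \<open>a + 1\<close> and block
  column \<open>b + 1\<close> in the usual numbering from 1.
\<close>

type_synonym 'n bvec = "nat \<Rightarrow> real^'n"
type_synonym 'n bmat = "nat \<Rightarrow> nat \<Rightarrow> real^'n^'n"

definition bvnorm :: "ereal \<Rightarrow> nat \<Rightarrow> 'n::finite bvec \<Rightarrow> real" where
  "bvnorm p m v = pnorm p ({..m} \<times> UNIV) (\<lambda>(k, a). v k $ a)"

definition bapply :: "nat \<Rightarrow> 'n::finite bmat \<Rightarrow> 'n bvec \<Rightarrow> 'n bvec" where
  "bapply m A v = (\<lambda>a. \<Sum>b\<le>m. A a b *v v b)"

definition bmult :: "nat \<Rightarrow> 'n::finite bmat \<Rightarrow> 'n bmat \<Rightarrow> 'n bmat" where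
  "bmult m A B = (\<lambda>a b. \<Sum>c\<le>m. A a c ** B c b)"

definition bone :: "'n::finite bmat" where
  "bone = (\<lambda>a b. if a = b then mat 1 else 0)"

definition binv :: "nat \<Rightarrow> 'n::finite bmat \<Rightarrow> 'n bmat" where
  "binv m A = (SOME B. \<forall>a\<le>m. \<forall>b\<le>m.
     bmult m A B a b = bone a b \<and> bmult m B A a b = bone a b)"

definition bnorm :: "ereal \<Rightarrow> nat \<Rightarrow> 'n::finite bmat \<Rightarrow> real" where
  "bnorm p m A = (SUP v\<in>{v. bvnorm p m v = 1}. bvnorm p m (bapply m A v))"

definition bmeasure :: "ereal \<Rightarrow> nat \<Rightarrow> 'n::finite bmat \<Rightarrow> real" where
  "bmeasure p m A =
    Lim (at_right 0) (\<lambda>h. (bnorm p m (\<lambda>a b. bone a b + h *\<^sub>R A a b) - 1) / h)"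

definition bcond :: "ereal \<Rightarrow> nat \<Rightarrow> 'n::finite bmat \<Rightarrow> real" where
  "bcond p m T = bnorm p m T * bnorm p m (binv m T)"

definition bconj :: "nat \<Rightarrow> 'n::finite bmat \<Rightarrow> 'n bmat \<Rightarrow> 'n bmat" where
  "bconj m T A = bmult m (bmult m T A) (binv m T)"

text \<open>With 0-based blocks, \<open>\<alpha> k\<close> for \<open>k = 1, \<dots>, m\<close> is in block \<open>(k - 1, k)\<close>.\<close>

definition Tbar :: "(nat \<Rightarrow> real) \<Rightarrow> 'n::finite bmat" where
  "Tbar \<alpha> = (\<lambda>a b. if a = b then mat 1 else if b = Suc a then \<alpha> b *\<^sub>R mat 1 else 0)"


section \<open>Smooth functions and signals\<close>

text \<open>
  \<open>F X t\<close> is a function of time \<open>t \<ge> 0\<close> and of a family \<open>X\<close> of vectors.  It is r times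
  continuously differentiable if its iterated partial derivatives up to order r exist and are
  continuous (one-sided in time at \<open>t = 0\<close>).  The space \<open>'j \<Rightarrow> 'a\<close> carries the product topology;
  for a function of finitely many of the vectors \<open>X j\<close>, this is the usual finite-dimensional notion.
\<close>

primrec times_differentiable ::
    "nat \<Rightarrow> (('j \<Rightarrow> 'a::real_normed_vector) \<Rightarrow> real \<Rightarrow> 'b::real_normed_vector) \<Rightarrow> bool" where
  "times_differentiable 0 F \<longleftrightarrow> continuous_on (UNIV \<times> {0..}) (\<lambda>(X, t). F X t)"
| "times_differentiable (Suc r) F \<longleftrightarrow>
     continuous_on (UNIV \<times> {0..}) (\<lambda>(X, t). F X t) \<and>
     (\<forall>j v. \<exists>G. times_differentiable r G \<and>
        (\<forall>X. \<forall>t\<ge>0. ((\<lambda>s. F (X(j := X j + s *\<^sub>R v)) t) has_vector_derivative G X t) (at 0))) \<and>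
     (\<exists>G. times_differentiable r G \<and>
        (\<forall>X. \<forall>t\<ge>0. ((\<lambda>s. F X s) has_vector_derivative G X t) (at t within {0..})))"

definition smooth ::
    "(('j \<Rightarrow> 'a::real_normed_vector) \<Rightarrow> real \<Rightarrow> 'b::real_normed_vector) \<Rightarrow> bool" where
  "smooth F \<longleftrightarrow> (\<forall>r. times_differentiable r F)"

definition piecewise_continuous_from :: "real \<Rightarrow> (real \<Rightarrow> 'a::topological_space) \<Rightarrow> bool" where
  "piecewise_continuous_from a g \<longleftrightarrow>
     (\<forall>b. finite {t\<in>{a..b}. \<not> continuous (at t within {a..}) g}) \<and>
     (\<forall>t\<ge>a. \<exists>l. (g \<longlongrightarrow> l) (at_right t)) \<and>
     (\<forall>t>a. \<exists>l. (g \<longlongrightarrow> l) (at_left t))"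

definition Linf :: "ereal \<Rightarrow> real \<Rightarrow> (real \<Rightarrow> real^'n) \<Rightarrow> real" where
  "Linf p a w = (SUP t\<in>{a..}. vnorm p (w t))"


section \<open>The network\<close>

text \<open>
  The data of a network of \<open>N\<close> agents \<open>1, \<dots>, N\<close> and \<open>leaders\<close> leaders \<open>1, \<dots>, leaders\<close>.  The
  couplings \<open>coupl i k x z t\<close> and \<open>dcoupl i k x z t\<close> are functions of the stacked states \<open>x\<close>, of
  the stacked reference \<open>z\<close> and of time; the delay is substituted in the dynamics.
\<close>

record ('n::finite) network =
  start :: real
  vfield :: "nat \<Rightarrow> real^'n \<Rightarrow> real \<Rightarrow> real^'n"
  outmap :: "nat \<Rightarrow> real^'n \<Rightarrow> real^'n"
  nbrs :: "nat \<Rightarrow> nat set"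
  leaders :: nat
  leader_ref :: "nat \<Rightarrow> real \<Rightarrow> real^'n"
  delay :: "real \<Rightarrow> real"
  coupl :: "nat \<Rightarrow> nat \<Rightarrow> (nat \<Rightarrow> real^'n) \<Rightarrow> (nat \<Rightarrow> real^'n) \<Rightarrow> real \<Rightarrow> real^'n"
  dcoupl :: "nat \<Rightarrow> nat \<Rightarrow> (nat \<Rightarrow> real^'n) \<Rightarrow> (nat \<Rightarrow> real^'n) \<Rightarrow> real \<Rightarrow> real^'n"

definition smooth_coupling ::
    "nat set \<Rightarrow> nat set \<Rightarrow> ((nat \<Rightarrow> real^'n) \<Rightarrow> (nat \<Rightarrow> real^'n) \<Rightarrow> real \<Rightarrow> real^'n::finite) \<Rightarrow> bool"
  where
  "smooth_coupling J L h \<longleftrightarrow>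
     (\<forall>x x' z z'. \<forall>t\<ge>0. (\<forall>j\<in>J. x j = x' j) \<longrightarrow> (\<forall>l\<in>L. z l = z' l) \<longrightarrow> h x z t = h x' z' t) \<and>
     smooth (\<lambda>(X :: nat + nat \<Rightarrow> real^'n) t. h (\<lambda>j. X (Inl j)) (\<lambda>l. X (Inr l)) t)"

definition multiplex_network :: "nat \<Rightarrow> nat \<Rightarrow> real \<Rightarrow> nat \<Rightarrow> 'n::finite network \<Rightarrow> bool" where
  "multiplex_network m nbound \<tau>max N \<N> \<longleftrightarrow>
     0 \<le> start \<N> \<and>
     (\<forall>t\<ge>start \<N>. 0 \<le> delay \<N> t \<and> delay \<N> t \<le> \<tau>max) \<and>
     (\<forall>i\<in>{1..N}.
        smooth (\<lambda>(X :: unit \<Rightarrow> real^'n) t. vfield \<N> i (X ()) t) \<and>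
        nbrs \<N> i \<subseteq> {1..N} - {i} \<and> card (nbrs \<N> i) \<le> nbound \<and>
        (\<forall>k\<le>m. smooth_coupling (insert i (nbrs \<N> i)) {1..leaders \<N>} (coupl \<N> i k) \<and>
               smooth_coupling (insert i (nbrs \<N> i)) {1..leaders \<N>} (dcoupl \<N> i k)))"

text \<open>The values of the couplings along a state trajectory.\<close>

definition coupl_at :: "'n::finite network \<Rightarrow> nat \<Rightarrow> nat \<Rightarrow> (nat \<Rightarrow> real \<Rightarrow> real^'n) \<Rightarrow> real \<Rightarrow> real^'n"
  where
  "coupl_at \<N> i k x t = coupl \<N> i k (\<lambda>j. x j t) (\<lambda>l. leader_ref \<N> l t) t"

definition dcoupl_at :: "'n::finite network \<Rightarrow> nat \<Rightarrow> nat \<Rightarrow> (nat \<Rightarrow> real \<Rightarrow> real^'n) \<Rightarrow> real \<Rightarrow> real^'n"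
  where
  "dcoupl_at \<N> i k x t =
     dcoupl \<N> i k (\<lambda>j. x j (t - delay \<N> t)) (\<lambda>l. leader_ref \<N> l (t - delay \<N> t)) t"

definition dbar :: "nat \<Rightarrow> (nat \<Rightarrow> real^'n) \<Rightarrow> real \<Rightarrow> real^'n" where
  "dbar m c t = (\<Sum>k<m. t ^ k *\<^sub>R c k)"

definition input ::
    "'n::finite network \<Rightarrow> (nat \<Rightarrow> real \<Rightarrow> real^'n) \<Rightarrow> (nat \<Rightarrow> nat \<Rightarrow> real \<Rightarrow> real^'n) \<Rightarrow>
     nat \<Rightarrow> real \<Rightarrow> real^'n" where
  "input \<N> x r i t = coupl_at \<N> i 0 x t + dcoupl_at \<N> i 0 x t + r i 1 t"

text \<open>
  Since \<open>w\<close> is only piecewise continuous, the differential equations are required off a set having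
  finitely many points in every bounded interval.  The initial functions are the restrictions of
  \<open>x i\<close> and \<open>r i k\<close> to \<open>[start - \<tau>max, start]\<close>.
\<close>

definition closed_loop ::
    "nat \<Rightarrow> real \<Rightarrow> nat \<Rightarrow> 'n::finite network \<Rightarrow> (nat \<Rightarrow> real \<Rightarrow> real^'n) \<Rightarrow> (nat \<Rightarrow> nat \<Rightarrow> real^'n) \<Rightarrow>
     (nat \<Rightarrow> real \<Rightarrow> real^'n) \<Rightarrow> (nat \<Rightarrow> nat \<Rightarrow> real \<Rightarrow> real^'n) \<Rightarrow> bool" where
  "closed_loop m \<tau>max N \<N> w c x r \<longleftrightarrow>
     (\<forall>i\<in>{1..N}. continuous_on {start \<N> - \<tau>max..} (x i) \<and>
        (\<forall>k\<in>{1..m}. continuous_on {start \<N> - \<tau>max..} (r i k))) \<and>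
     (\<exists>S. (\<forall>b. finite (S \<inter> {start \<N>..b})) \<and>
        (\<forall>i\<in>{1..N}. \<forall>t\<in>{start \<N>..} - S.
           (x i has_vector_derivative
              vfield \<N> i (x i t) t + input \<N> x r i t + (w i t + dbar m (c i) t))
             (at t within {start \<N>..}) \<and>
           (\<forall>k\<in>{1..<m}. (r i k has_vector_derivative
              coupl_at \<N> i k x t + dcoupl_at \<N> i k x t + r i (k + 1) t)
             (at t within {start \<N>..})) \<and>
           (r i m has_vector_derivative coupl_at \<N> i m x t + dcoupl_at \<N> i m x t)
             (at t within {start \<N>..})))"

definition disturbance :: "nat \<Rightarrow> 'n::finite network \<Rightarrow> (nat \<Rightarrow> real \<Rightarrow> real^'n) \<Rightarrow> bool" where
  "disturbance N \<N> w \<longleftrightarrow>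
     (\<forall>i\<in>{1..N}. piecewise_continuous_from (start \<N>) (w i) \<and> bounded (w i ` {start \<N>..}))"

definition desired_solution ::
    "real \<Rightarrow> nat \<Rightarrow> 'n::finite network \<Rightarrow> (nat \<Rightarrow> real \<Rightarrow> real^'n) \<Rightarrow> bool" where
  "desired_solution \<tau>max N \<N> xs \<longleftrightarrow>
     (\<forall>i\<in>{1..N}.
        (\<forall>t\<ge>start \<N>. (xs i has_vector_derivative vfield \<N> i (xs i t) t) (at t within {start \<N>..})) \<and>
        (\<forall>s\<in>{start \<N> - \<tau>max..start \<N>}. xs i s = xs i (start \<N>)))"


section \<open>Scalability\<close>

definition class_K :: "ereal \<Rightarrow> (real \<Rightarrow> real) \<Rightarrow> bool" where
  "class_K a \<gamma> \<longleftrightarrow>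
     continuous_on {r. 0 \<le> r \<and> ereal r < a} \<gamma> \<and>
     strict_mono_on {r. 0 \<le> r \<and> ereal r < a} \<gamma> \<and> \<gamma> 0 = 0"

definition class_KL :: "ereal \<Rightarrow> (real \<Rightarrow> real \<Rightarrow> real) \<Rightarrow> bool" where
  "class_KL a \<beta> \<longleftrightarrow>
     continuous_on ({r. 0 \<le> r \<and> ereal r < a} \<times> {0..}) (\<lambda>(r, s). \<beta> r s) \<and>
     (\<forall>s\<ge>0. class_K a (\<lambda>r. \<beta> r s)) \<and>
     (\<forall>r. 0 \<le> r \<and> ereal r < a \<longrightarrow> antimono_on {0..} (\<beta> r) \<and> (\<beta> r \<longlongrightarrow> 0) at_top)"

definition dbar_deriv :: "nat \<Rightarrow> nat \<Rightarrow> (nat \<Rightarrow> real^'n) \<Rightarrow> real \<Rightarrow> real^'n" where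
  "dbar_deriv m k c = ((\<lambda>g t. vector_derivative g (at t)) ^^ k) (dbar m c)"

text \<open>
  The gains are defined on all of \<open>[0, \<infinity>)\<close>, as they are applied to arbitrary initial deviations
  and disturbances, and they depend neither on \<open>N\<close> nor on the disturbances.
\<close>

definition input_to_state_scalable ::
    "ereal \<Rightarrow> nat \<Rightarrow> real \<Rightarrow> (nat \<Rightarrow> 'n::finite network) \<Rightarrow> (nat \<Rightarrow> nat \<Rightarrow> real \<Rightarrow> real^'n) \<Rightarrow> bool" where
  "input_to_state_scalable p m \<tau>max net xs \<longleftrightarrow>
     (\<exists>\<alpha> \<beta> \<gamma>. class_KL \<infinity> \<alpha> \<and> class_KL \<infinity> \<beta> \<and> class_K \<infinity> \<gamma> \<and>
       (\<forall>N\<ge>2. \<forall>w c x r. disturbance N (net N) w \<longrightarrow> closed_loop m \<tau>max N (net N) w c x r \<longrightarrow>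
         (\<forall>t\<ge>start (net N).
           (MAX i\<in>{1..N}. vnorm p (x i t - xs N i t))
           \<le> \<gamma> (MAX i\<in>{1..N}. Linf p (start (net N)) (w i))
             + \<alpha> (MAX i\<in>{1..N}. SUP s\<in>{start (net N) - \<tau>max..start (net N)}.
                     vnorm p (x i s - xs N i s)) (t - start (net N))
             + \<beta> (MAX i\<in>{1..N}. SUP s\<in>{start (net N) - \<tau>max..start (net N)}.
                     \<Sum>k=1..m. vnorm p (r i k s + dbar_deriv m (k - 1) (c i) s))
                 (t - start (net N)))))"


section \<open>The block Jacobians\<close>

text \<open>\<open>d_state h j x z t\<close> is the partial Jacobian of \<open>h\<close> with respect to the state of agent \<open>j\<close>.\<close>

definition d_state ::
    "((nat \<Rightarrow> real^'n) \<Rightarrow> (nat \<Rightarrow> real^'n) \<Rightarrow> real \<Rightarrow> real^'n::finite) \<Rightarrow> nat \<Rightarrow>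
     (nat \<Rightarrow> real^'n) \<Rightarrow> (nat \<Rightarrow> real^'n) \<Rightarrow> real \<Rightarrow> real^'n^'n" where
  "d_state h j x z t = jacobian (\<lambda>y. h (x(j := y)) z t) (at (x j))"

definition Adiag ::
    "'n::finite network \<Rightarrow> nat \<Rightarrow> (nat \<Rightarrow> real^'n) \<Rightarrow> (nat \<Rightarrow> real^'n) \<Rightarrow> real \<Rightarrow> 'n bmat" where
  "Adiag \<N> i x z t = (\<lambda>a b.
     if a = 0 \<and> b = 0
       then jacobian (\<lambda>y. vfield \<N> i y t) (at (x i)) + d_state (coupl \<N> i 0) i x z t
     else if b = 0 then d_state (coupl \<N> i a) i x z t
     else if b = Suc a then mat 1
     else 0)"

definition Aoff ::
    "'n::finite network \<Rightarrow> nat \<Rightarrow> nat \<Rightarrow> (nat \<Rightarrow> real^'n) \<Rightarrow> (nat \<Rightarrow> real^'n) \<Rightarrow> real \<Rightarrow> 'n bmat" where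
  "Aoff \<N> i j x z t = (\<lambda>a b. if b = 0 then d_state (coupl \<N> i a) j x z t else 0)"

definition Bdel ::
    "'n::finite network \<Rightarrow> nat \<Rightarrow> nat \<Rightarrow> (nat \<Rightarrow> real^'n) \<Rightarrow> (nat \<Rightarrow> real^'n) \<Rightarrow> real \<Rightarrow> 'n bmat" where
  "Bdel \<N> i j x z t = (\<lambda>a b. if b = 0 then d_state (dcoupl \<N> i a) j x z t else 0)"

end

theory Submission
  imports Defs
begin

text \<open>
  Measure the deviation of agent i, consisting of its state error and of the errors of the layers,
  by \<open>V i = |T z i|\<close>.  Let \<open>\<phi>\<close> be a norming functional of \<open>T z i\<close> at time t, that is
  \<open>\<phi> (T z i) = V i\<close> and \<open>\<phi> \<le> |.|\<close> everywhere.  Then \<open>\<phi> (T z i s) \<le> V i s\<close> with equality at \<open>s = t\<close>,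
  so \<open>\<phi> (T z i')\<close> bounds the left derivative of \<open>V i\<close> at t.  By the mean value theorem for a
  scalar function it is the value of \<open>\<phi>\<close> at a combination of Jacobians taken at one intermediate
  point, which (C2) and (C3) bound by \<open>- \<sigma>hi V i + \<sigma>lo sup V + |T| |w|\<close> as soon as \<open>V i\<close> is the
  largest of all \<open>V j\<close>.  A first-crossing argument of Halanay type against
  \<open>|T| |w| / (\<sigma>hi - \<sigma>lo) + M exp (- rate (t - t0))\<close> concludes.  Neither time integrals nor Dini
  derivatives are needed, so the delay and the reference signal may be arbitrary functions of time.
\<close>

section \<open>p-norms and their norming functionals\<close>

text \<open>Adding to \<open>r i k\<close> the derivative of order k - 1 of the polynomial
  disturbance removes that disturbance from the error dynamics: differentiating one layer yields the
  term that completes the next, and the last layer needs none, since a polynomial of degree below m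
  has zero derivative of order m. Only w is left, in block 0. A norm may have corners, and the mean
  value theorem for vectors gives no single intermediate point, while (C2) speaks of a single
  Jacobian. Freezing one functional removes both obstacles. The intermediate states need not lie on
  a trajectory, and the delayed couplings have their own; this is harmless as (C2) and (C3) hold for
  all states and all leader values. The comparison function turns the derivative bound into an
  identity up to a margin: its constant level K balances
  \<open>\<sigma>hi * K = \<sigma>lo * K + |T| W\<close>, and its exponential grows, looking back
  over one delay, by at most \<open>exp (rate * \<tau>max)\<close>, where
  \<open>\<sigma>lo * exp (rate * \<tau>max) = \<sigma>hi - rate\<close>. Other agents enter only
  through the sums in (C2) and (C3), so no constant depends on N.\<close>

lemma pnorm_nonneg:
  assumes "finite I" "I \<noteq> {}"
  shows "0 \<le> pnorm p I v"
proof (cases "p = \<infinity>")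
  case True
  obtain k where "k \<in> I" using assms by blast
  then have "\<bar>v k\<bar> \<le> (MAX i\<in>I. \<bar>v i\<bar>)" using assms by simp
  then show ?thesis using True by (simp add: pnorm_def)
qed (simp add: pnorm_def)

lemma pnorm_ereal:
  "pnorm (ereal q) I v = (\<Sum>i\<in>I. \<bar>v i\<bar> powr q) powr (1 / q)"
  by (simp add: pnorm_def)

lemma abs_le_pnorm:
  assumes "finite I" "k \<in> I" "1 \<le> p"
  shows "\<bar>v k\<bar> \<le> pnorm p I v"
proof (cases p)
  case (real q)
  with assms have q: "1 \<le> q" by (simp add: one_ereal_def)
  have "\<bar>v k\<bar> = (\<bar>v k\<bar> powr q) powr (1 / q)" using q by (simp add: powr_powr)
  also have "\<dots> \<le> (\<Sum>i\<in>I. \<bar>v i\<bar> powr q) powr (1 / q)"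
    using q assms by (intro powr_mono2 member_le_sum) auto
  finally show ?thesis by (simp add: real pnorm_ereal)
qed (use assms in \<open>auto simp: pnorm_def\<close>)

text \<open>Weighted arithmetic-geometric mean of \<open>a powr q\<close> and
  \<open>b powr q\<close>. Weights 1 - 1/q and 1/q in place of a conjugate exponent keep q = 1
  included.\<close>

lemma Young_powr:
  fixes a b q :: real
  assumes "1 \<le> q" "0 \<le> a" "0 \<le> b"
  shows "a powr (q - 1) * b \<le> (1 - 1/q) * a powr q + (1/q) * b powr q"
proof (cases "a = 0 \<or> b = 0")
  case True
  then show ?thesis using assms by auto
next
  case False
  have "(a powr q) powr (1 - 1/q) * (b powr q) powr (1/q)
      \<le> (1 - 1/q) * a powr q + (1/q) * b powr q"
    using assms False by (intro Youngs_inequality_0) auto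
  moreover have "(a powr q) powr (1 - 1/q) = a powr (q - 1)"
    using assms by (simp add: powr_powr right_diff_distrib)
  moreover have "(b powr q) powr (1/q) = b"
    using assms by (simp add: powr_powr)
  ultimately show ?thesis by simp
qed

text \<open>For finite p, the functional attaining the norm is the one of the equality case in
  Hoelder's inequality; the bound is Young's inequality summed over the coordinates.\<close>

lemma pnorm_support:
  assumes "finite I" "I \<noteq> {}" "1 \<le> p"
  obtains \<phi> where "(\<Sum>i\<in>I. \<phi> i * v i) = pnorm p I v"
    and "\<And>u. (\<Sum>i\<in>I. \<phi> i * u i) \<le> pnorm p I u"
proof (cases p)
  case PInf
  have "(MAX i\<in>I. \<bar>v i\<bar>) \<in> (\<lambda>i. \<bar>v i\<bar>) ` I" using assms by (intro Max_in) auto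
  then obtain k where k: "k \<in> I" "(MAX i\<in>I. \<bar>v i\<bar>) = \<bar>v k\<bar>" by auto
  define \<phi> where "\<phi> i = (if i = k then sgn (v k) else 0)" for i
  have e: "(\<Sum>i\<in>I. \<phi> i * u i) = sgn (v k) * u k" for u
    using assms k by (simp add: \<phi>_def if_distrib[where f="\<lambda>x. x * _"] cong: if_cong)
  show ?thesis
  proof
    show "(\<Sum>i\<in>I. \<phi> i * v i) = pnorm p I v"
      using k PInf by (simp add: e pnorm_def abs_sgn mult.commute)
    fix u
    have "sgn (v k) * u k \<le> \<bar>u k\<bar>" by (simp add: sgn_if abs_if)
    then show "(\<Sum>i\<in>I. \<phi> i * u i) \<le> pnorm p I u"
      using abs_le_pnorm[OF assms(1) k(1) assms(3), of u] by (simp add: e)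
  qed
next
  case (real q)
  with assms have q: "1 \<le> q" by (simp add: one_ereal_def)
  have pq: "pnorm p I u powr q = (\<Sum>i\<in>I. \<bar>u i\<bar> powr q)" for u
    using q by (simp add: real pnorm_ereal powr_powr sum_nonneg)
  have unit: "(\<Sum>i\<in>I. (\<bar>u i\<bar> / pnorm p I u) powr q) = 1" if "pnorm p I u > 0" for u
    using that q by (simp add: powr_divide flip: sum_divide_distrib pq)
  show ?thesis
  proof (cases "pnorm p I v = 0")
    case True
    show ?thesis
      by (rule that[of "\<lambda>_. 0"]) (use True pnorm_nonneg[OF assms(1,2)] in auto)
  next
    case False
    define c where "c = pnorm p I v"
    have c: "c > 0" using False pnorm_nonneg[OF assms(1,2), of p v] by (simp add: c_def)
    define \<phi> where "\<phi> i = sgn (v i) * (\<bar>v i\<bar> / c) powr (q - 1)" for i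
    have "\<phi> i * v i = c * (\<bar>v i\<bar> / c) powr q" for i
    proof (cases "v i = 0")
      case False
      then have "(\<bar>v i\<bar> / c) powr q = (\<bar>v i\<bar> / c) powr (q - 1) * (\<bar>v i\<bar> / c)"
        using c powr_add[of "\<bar>v i\<bar> / c" "q - 1" 1] by simp
      then show ?thesis using c by (simp add: \<phi>_def abs_sgn mult_ac)
    qed (simp add: \<phi>_def)
    then have eq: "(\<Sum>i\<in>I. \<phi> i * v i) = pnorm p I v"
      using unit[of v] c by (simp add: c_def flip: sum_distrib_left)
    have le: "(\<Sum>i\<in>I. \<phi> i * u i) \<le> pnorm p I u" for u
    proof (cases "pnorm p I u = 0")
      case True
      then have "u i = 0" if "i \<in> I" for i
        using abs_le_pnorm[OF assms(1) that assms(3), of u] by simp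
      then show ?thesis using True by simp
    next
      case False
      define d where "d = pnorm p I u"
      have d: "d > 0" using False pnorm_nonneg[OF assms(1,2), of p u] by (simp add: d_def)
      \<comment> \<open>Young is applied to the normalised coordinates of v and u. By
        \<open>unit\<close> their q-th powers sum to 1, so the right-hand sides add up to exactly
        d.\<close>
      have "\<phi> i * u i \<le> d * ((1 - 1/q) * (\<bar>v i\<bar> / c) powr q + (1/q) * (\<bar>u i\<bar> / d) powr q)" for i
      proof -
        have "\<phi> i * u i \<le> \<bar>\<phi> i\<bar> * \<bar>u i\<bar>" by (simp flip: abs_mult)
        also have "\<dots> \<le> (\<bar>v i\<bar> / c) powr (q - 1) * \<bar>u i\<bar>"
          by (intro mult_right_mono) (auto simp: \<phi>_def abs_mult sgn_if)
        also have "\<dots> = d * ((\<bar>v i\<bar> / c) powr (q - 1) * (\<bar>u i\<bar> / d))" using d by simp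
        also have "\<dots> \<le> d * ((1 - 1/q) * (\<bar>v i\<bar> / c) powr q + (1/q) * (\<bar>u i\<bar> / d) powr q)"
          using q c d by (intro mult_left_mono Young_powr) auto
        finally show ?thesis .
      qed
      then have "(\<Sum>i\<in>I. \<phi> i * u i)
          \<le> (\<Sum>i\<in>I. d * ((1 - 1/q) * (\<bar>v i\<bar> / c) powr q + (1/q) * (\<bar>u i\<bar> / d) powr q))"
        by (intro sum_mono)
      also have "\<dots> = d * ((1 - 1/q) * (\<Sum>i\<in>I. (\<bar>v i\<bar> / c) powr q)
          + (1/q) * (\<Sum>i\<in>I. (\<bar>u i\<bar> / d) powr q))"
        by (simp add: sum.distrib distrib_left sum_distrib_left)
      also have "\<dots> = d" using unit[of u] unit[of v] c d by (simp add: c_def d_def)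
      finally show ?thesis by (simp add: d_def)
    qed
    show ?thesis using that[OF eq le] .
  qed
qed (use assms in auto)

text \<open>Minkowski's inequality: the functional that norms the sum splits linearly, and each part
  is at most the norm of its summand.\<close>

lemma pnorm_triangle:
  assumes "finite I" "I \<noteq> {}" "1 \<le> p"
  shows "pnorm p I (\<lambda>i. u i + v i) \<le> pnorm p I u + pnorm p I v"
proof -
  obtain \<phi> where \<phi>: "(\<Sum>i\<in>I. \<phi> i * (u i + v i)) = pnorm p I (\<lambda>i. u i + v i)"
    "\<And>u. (\<Sum>i\<in>I. \<phi> i * u i) \<le> pnorm p I u"
    using pnorm_support[OF assms, of "\<lambda>i. u i + v i"] by metis
  show ?thesis
    using \<phi>(2)[of u] \<phi>(2)[of v] by (simp add: distrib_left sum.distrib flip: \<phi>(1))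
qed

lemma pnorm_scale:
  assumes "finite I" "I \<noteq> {}" "1 \<le> p"
  shows "pnorm p I (\<lambda>i. c * v i) = \<bar>c\<bar> * pnorm p I v"
proof (cases p)
  case (real q)
  with assms have q: "1 \<le> q" by (simp add: one_ereal_def)
  have "(\<Sum>i\<in>I. \<bar>c * v i\<bar> powr q) = \<bar>c\<bar> powr q * (\<Sum>i\<in>I. \<bar>v i\<bar> powr q)"
    by (simp add: abs_mult powr_mult sum_distrib_left)
  then show ?thesis using q by (simp add: real pnorm_ereal powr_mult sum_nonneg powr_powr)
next
  case PInf
  have "(MAX i\<in>I. \<bar>c\<bar> * \<bar>v i\<bar>) = \<bar>c\<bar> * (MAX i\<in>I. \<bar>v i\<bar>)"
    using mono_Max_commute[of "\<lambda>x. \<bar>c\<bar> * x" "(\<lambda>i. \<bar>v i\<bar>) ` I"] assms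
    by (simp add: monoI mult_left_mono image_image)
  then show ?thesis by (simp add: PInf pnorm_def abs_mult)
qed (use assms in auto)

lemma pnorm_cong: "(\<And>i. i \<in> I \<Longrightarrow> u i = v i) \<Longrightarrow> pnorm p I u = pnorm p I v"
  by (simp add: pnorm_def cong: sum.cong image_cong_simp)

text \<open>Zero coordinates do not count; for p infinite this uses that J is nonempty. It
  identifies a single coordinate, or a single block, with its embedding.\<close>

lemma pnorm_extend:
  assumes "finite I" "inj_on f J" "f ` J \<subseteq> I" "J \<noteq> {}" "1 \<le> p"
    and "\<And>i. i \<in> I - f ` J \<Longrightarrow> v i = 0"
  shows "pnorm p I v = pnorm p J (\<lambda>j. v (f j))"
proof (cases p)
  case (real q)
  have "(\<Sum>i\<in>I. \<bar>v i\<bar> powr q) = (\<Sum>i\<in>f ` J. \<bar>v i\<bar> powr q)"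
    using assms by (intro sum.mono_neutral_right) auto
  also have "\<dots> = (\<Sum>j\<in>J. \<bar>v (f j)\<bar> powr q)" using assms by (simp add: sum.reindex)
  finally show ?thesis by (simp add: real pnorm_ereal)
next
  case PInf
  have fin: "finite J" using assms finite_subset finite_imageD by metis
  have "(MAX i\<in>I. \<bar>v i\<bar>) = (MAX j\<in>J. \<bar>v (f j)\<bar>)"
  proof (rule antisym)
    show "(MAX i\<in>I. \<bar>v i\<bar>) \<le> (MAX j\<in>J. \<bar>v (f j)\<bar>)"
    proof (rule Max.boundedI)
      fix y assume "y \<in> (\<lambda>i. \<bar>v i\<bar>) ` I"
      then obtain i where i: "i \<in> I" "y = \<bar>v i\<bar>" by blast
      obtain j where "j \<in> J" using assms by blast
      then have j: "\<bar>v (f j)\<bar> \<le> (MAX j\<in>J. \<bar>v (f j)\<bar>)" using fin by simp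
      show "y \<le> (MAX j\<in>J. \<bar>v (f j)\<bar>)"
      proof (cases "i \<in> f ` J")
        case True
        then show ?thesis using i fin by auto
      next
        case False
        then show ?thesis using i assms(6)[of i] j by simp
      qed
    qed (use assms in auto)
    show "(MAX j\<in>J. \<bar>v (f j)\<bar>) \<le> (MAX i\<in>I. \<bar>v i\<bar>)"
      using assms fin by (intro Max.boundedI) auto
  qed
  then show ?thesis by (simp add: PInf pnorm_def)
qed (use assms in auto)

lemma pnorm_mono_subset:
  assumes "finite I" "inj_on f J" "f ` J \<subseteq> I" "J \<noteq> {}" "1 \<le> p"
  shows "pnorm p J (\<lambda>j. v (f j)) \<le> pnorm p I v"
proof (cases p)
  case (real q)
  with assms have q: "1 \<le> q" by (simp add: one_ereal_def)
  have "(\<Sum>j\<in>J. \<bar>v (f j)\<bar> powr q) = (\<Sum>i\<in>f ` J. \<bar>v i\<bar> powr q)"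
    using assms by (simp add: sum.reindex)
  also have "\<dots> \<le> (\<Sum>i\<in>I. \<bar>v i\<bar> powr q)" using assms by (intro sum_mono2) auto
  finally show ?thesis using q by (simp add: real pnorm_ereal powr_mono2 sum_nonneg)
next
  case PInf
  have fin: "finite J" using assms finite_subset finite_imageD by metis
  show ?thesis using assms fin by (auto simp: PInf pnorm_def intro!: Max.boundedI)
qed (use assms in auto)

text \<open>Tested on vectors with one nonzero coordinate, the norming functional satisfies
  \<open>\<phi> i * v i \<le> \<bar>v i\<bar>\<close>, and these terms sum to the norm.\<close>

lemma pnorm_le_sum:
  assumes "finite I" "I \<noteq> {}" "1 \<le> p"
  shows "pnorm p I v \<le> (\<Sum>i\<in>I. \<bar>v i\<bar>)"
proof -
  obtain \<phi> where \<phi>: "(\<Sum>i\<in>I. \<phi> i * v i) = pnorm p I v"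
    "\<And>u. (\<Sum>i\<in>I. \<phi> i * u i) \<le> pnorm p I u"
    using pnorm_support[OF assms, of v] by metis
  have one: "pnorm p I (\<lambda>j. if j = i then s else 0) = \<bar>s\<bar>" if "i \<in> I" for i s
  proof -
    have "pnorm p I (\<lambda>j. if j = i then s else 0) = pnorm p {()} (\<lambda>_. s)"
      using pnorm_extend[of I "\<lambda>_. i" "{()}" p "\<lambda>j. if j = i then s else 0"] assms that by auto
    also have "\<dots> = \<bar>s\<bar>"
    proof (cases p)
      case (real q)
      with assms have "1 \<le> q" by (simp add: one_ereal_def)
      then show ?thesis by (simp add: real pnorm_ereal powr_powr)
    qed (use assms in \<open>auto simp: pnorm_def\<close>)
    finally show ?thesis .
  qed
  have "\<phi> i * v i \<le> \<bar>v i\<bar>" if "i \<in> I" for i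
    using \<phi>(2)[of "\<lambda>j. if j = i then v i else 0"] one[OF that, of "v i"] assms that
    by (simp add: if_distrib[where f="\<lambda>x. _ * x"] cong: if_cong)
  then show ?thesis unfolding \<phi>(1)[symmetric] by (rule sum_mono)
qed

section \<open>Block vectors and block matrices\<close>

abbreviation (input) bdot :: "nat \<Rightarrow> (nat \<Rightarrow> real^'n) \<Rightarrow> (nat \<Rightarrow> real^'n) \<Rightarrow> real" where
  "bdot m \<phi> v \<equiv> \<Sum>k\<le>m. \<phi> k \<bullet> v k"

lemma bvnorm_cong: "(\<And>k. k \<le> m \<Longrightarrow> u k = v k) \<Longrightarrow> bvnorm p m u = bvnorm p m v"
  unfolding bvnorm_def by (intro pnorm_cong) auto

lemma bvnorm_nonneg: "0 \<le> bvnorm p m v"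
  unfolding bvnorm_def by (intro pnorm_nonneg) auto

lemma bvnorm_triangle:
  "1 \<le> p \<Longrightarrow> bvnorm p m (\<lambda>k. u k + v k) \<le> bvnorm p m u + bvnorm p m v"
  using pnorm_triangle[of "{..m} \<times> UNIV" p "\<lambda>(k, a). u k $ a" "\<lambda>(k, a). v k $ a"]
  unfolding bvnorm_def by (simp add: case_prod_unfold)

lemma bvnorm_scale: "1 \<le> p \<Longrightarrow> bvnorm p m (\<lambda>k. c *\<^sub>R v k) = \<bar>c\<bar> * bvnorm p m v"
  using pnorm_scale[of "{..m} \<times> UNIV" p c "\<lambda>(k, a). v k $ a"]
  unfolding bvnorm_def by (simp add: case_prod_unfold)

lemma bvnorm_support:
  fixes v :: "nat \<Rightarrow> real^'n"
  assumes "1 \<le> p"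
  obtains \<phi> where "bdot m \<phi> v = bvnorm p m v" and "\<And>u. bdot m \<phi> u \<le> bvnorm p m u"
proof -
  obtain \<psi> where \<psi>: "(\<Sum>i\<in>{..m} \<times> (UNIV::'n set). \<psi> i * (case i of (k, a) \<Rightarrow> v k $ a)) = bvnorm p m v"
    "\<And>u. (\<Sum>i\<in>{..m} \<times> (UNIV::'n set). \<psi> i * u i) \<le> pnorm p ({..m} \<times> UNIV) u"
    using pnorm_support[of "{..m} \<times> (UNIV::'n set)" p "\<lambda>(k, a). v k $ a"] assms
    unfolding bvnorm_def by auto
  have "bdot m (\<lambda>k. \<chi> a. \<psi> (k, a)) u
      = (\<Sum>i\<in>{..m} \<times> (UNIV::'n set). \<psi> i * (case i of (k, a) \<Rightarrow> u k $ a))" for u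
    by (simp add: inner_vec_def sum.cartesian_product case_prod_unfold)
  then show ?thesis
    using that[of "\<lambda>k. \<chi> a. \<psi> (k, a)"] \<psi> unfolding bvnorm_def by simp
qed

lemma vnorm_le_bvnorm: "1 \<le> p \<Longrightarrow> k \<le> m \<Longrightarrow> vnorm p (v k) \<le> bvnorm p m v"
  unfolding vnorm_def bvnorm_def
  using pnorm_mono_subset[of "{..m} \<times> UNIV" "\<lambda>a. (k, a)" UNIV p "\<lambda>(k, a). v k $ a"]
  by (auto simp: inj_on_def)

lemma vnorm_nonneg: "0 \<le> vnorm p v"
  unfolding vnorm_def by (intro pnorm_nonneg) auto

lemma abs_le_vnorm: "1 \<le> p \<Longrightarrow> \<bar>v $ a\<bar> \<le> vnorm p v"
  unfolding vnorm_def by (intro abs_le_pnorm) auto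

lemma vnorm_le: "1 \<le> p \<Longrightarrow> vnorm p (v :: real^'n) \<le> real CARD('n) * norm v"
  unfolding vnorm_def
  by (rule order_trans[OF pnorm_le_sum], simp_all)
     (metis (no_types, lifting) component_le_norm_cart sum_bounded_above)

lemma bvnorm_single:
  assumes "1 \<le> p" "k \<le> m"
  shows "bvnorm p m (\<lambda>j. if j = k then v else 0) = vnorm p v"
proof -
  let ?f = "\<lambda>(j, a). (if j = k then v else 0) $ a"
  have "pnorm p ({..m} \<times> UNIV) ?f = pnorm p UNIV (\<lambda>a. ?f (k, a))"
    using assms by (intro pnorm_extend) (auto simp: inj_on_def)
  then show ?thesis by (simp add: vnorm_def bvnorm_def)
qed

lemma bvnorm_le_sum:
  assumes "1 \<le> p"
  shows "bvnorm p m v \<le> (\<Sum>k\<le>m. vnorm p (v k))"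
proof -
  obtain \<phi> where \<phi>: "bdot m \<phi> v = bvnorm p m v" "\<And>u. bdot m \<phi> u \<le> bvnorm p m u"
    using bvnorm_support[OF assms] by metis
  have "\<phi> k \<bullet> v k \<le> vnorm p (v k)" if "k \<le> m" for k
    using \<phi>(2)[of "\<lambda>j. if j = k then v k else 0"] bvnorm_single[OF assms that, of "v k"] that
    by (simp add: if_distrib[where f="\<lambda>x. _ \<bullet> x"] cong: if_cong)
  then show ?thesis unfolding \<phi>(1)[symmetric] by (intro sum_mono) auto
qed

section \<open>Action of block matrices, operator norm and matrix measure\<close>

lemma bapply_cong: "(\<And>b. b \<le> m \<Longrightarrow> u b = v b) \<Longrightarrow> bapply m A u = bapply m A v"
  unfolding bapply_def by auto

lemma bapply_add: "bapply m A (\<lambda>k. u k + v k) = (\<lambda>k. bapply m A u k + bapply m A v k)"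
  unfolding bapply_def by (simp add: matrix_vector_right_distrib sum.distrib)

lemma bapply_sum: "bapply m A (\<lambda>k. \<Sum>j\<in>J. u j k) = (\<lambda>k. \<Sum>j\<in>J. bapply m A (u j) k)"
  unfolding bapply_def
  by (rule ext, subst sum.swap)
     (simp add: linear_sum[OF matrix_vector_mul_linear])

lemma bapply_scale: "bapply m A (\<lambda>k. c *\<^sub>R v k) = (\<lambda>k. c *\<^sub>R bapply m A v k)"
  unfolding bapply_def by (simp add: matrix_vector_mult_scaleR scaleR_sum_right)

lemma bapply_bmult: "bapply m (bmult m A B) v = bapply m A (bapply m B v)"
proof
  fix a
  have "(\<Sum>c\<le>m. A a c ** B c b) *v x = (\<Sum>c\<le>m. A a c *v (B c b *v x))" for b x
    using bounded_linear.linear[OF matrix_vector_mul_bounded_linear]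
    by (induction "m::nat") (auto simp: matrix_vector_mult_add_rdistrib matrix_vector_mul_assoc)
  then have "bapply m (bmult m A B) v a = (\<Sum>b\<le>m. \<Sum>c\<le>m. A a c *v (B c b *v v b))"
    by (simp add: bapply_def bmult_def)
  also have "\<dots> = (\<Sum>c\<le>m. \<Sum>b\<le>m. A a c *v (B c b *v v b))" by (rule sum.swap)
  finally show "bapply m (bmult m A B) v a = bapply m A (bapply m B v) a"
    by (simp add: bapply_def linear_sum[OF matrix_vector_mul_linear])
qed

lemma bapply_bone: "a \<le> m \<Longrightarrow> bapply m bone v a = v a"
  by (simp add: bapply_def bone_def if_distrib[where f="\<lambda>M. M *v _"] cong: if_cong)

text \<open>The constant is crude: it is only there to make the set under the supremum in
  \<open>bnorm\<close> bounded above.\<close>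

lemma bvnorm_bapply_bound:
  fixes A :: "'n::finite bmat"
  assumes "1 \<le> p"
  obtains C where "\<And>v. bvnorm p m (bapply m A v) \<le> C * bvnorm p m v"
proof
  fix v :: "'n bvec"
  define C where "C = (\<Sum>a\<le>m. real CARD('n) * (\<Sum>b\<le>m. onorm ((*v) (A a b)) * real CARD('n)))"
  have v: "norm (v b) \<le> real CARD('n) * bvnorm p m v" if "b \<le> m" for b
  proof -
    have "norm (v b) \<le> (\<Sum>a\<in>UNIV. \<bar>v b $ a\<bar>)" by (rule norm_le_l1_cart)
    also have "\<dots> \<le> (\<Sum>a\<in>(UNIV::'n set). bvnorm p m v)"
      using abs_le_vnorm[OF assms, of "v b"] vnorm_le_bvnorm[OF assms that, of v]
      by (intro sum_mono) (meson order_trans)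
    finally show ?thesis by simp
  qed
  have "vnorm p (bapply m A v a)
      \<le> real CARD('n) * (\<Sum>b\<le>m. onorm ((*v) (A a b)) * real CARD('n)) * bvnorm p m v" for a
  proof -
    have "norm (bapply m A v a) \<le> (\<Sum>b\<le>m. norm (A a b *v v b))"
      unfolding bapply_def by (rule norm_sum)
    also have "\<dots> \<le> (\<Sum>b\<le>m. onorm ((*v) (A a b)) * (real CARD('n) * bvnorm p m v))"
    proof (rule sum_mono)
      fix b assume "b \<in> {..m}"
      then have "norm (v b) \<le> real CARD('n) * bvnorm p m v" using v by simp
      then have "onorm ((*v) (A a b)) * norm (v b) \<le> onorm ((*v) (A a b)) * (real CARD('n) * bvnorm p m v)"
        by (intro mult_left_mono onorm_pos_le matrix_vector_mul_bounded_linear)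
      then show "norm (A a b *v v b) \<le> onorm ((*v) (A a b)) * (real CARD('n) * bvnorm p m v)"
        using onorm[OF matrix_vector_mul_bounded_linear, of "A a b" "v b"] by linarith
    qed
    finally have "real CARD('n) * norm (bapply m A v a)
        \<le> real CARD('n) * (\<Sum>b\<le>m. onorm ((*v) (A a b)) * (real CARD('n) * bvnorm p m v))"
      by (intro mult_left_mono) auto
    from order_trans[OF vnorm_le[OF assms] this] show ?thesis
      by (simp add: sum_distrib_right mult.assoc)
  qed
  then have "(\<Sum>a\<le>m. vnorm p (bapply m A v a)) \<le> C * bvnorm p m v"
    unfolding C_def sum_distrib_right by (intro sum_mono)
  with bvnorm_le_sum[OF assms, of m "bapply m A v"]
  show "bvnorm p m (bapply m A v) \<le> C * bvnorm p m v" by linarith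
qed

text \<open>Keeps the supremum in \<open>bnorm\<close> from being taken over the empty set. The
  all-ones vector has norm at least 1, hence can be normalised.\<close>

lemma bvnorm_unit: "1 \<le> p \<Longrightarrow> \<exists>v :: 'n::finite bvec. bvnorm p m v = 1"
proof -
  assume p: "1 \<le> p"
  have "bvnorm p m (\<lambda>_. 1 :: real^'n) \<ge> 1"
    using abs_le_vnorm[OF p, of "1 :: real^'n"] vnorm_le_bvnorm[OF p, of 0 m "\<lambda>_. 1 :: real^'n"]
    by simp
  then have "bvnorm p m (\<lambda>_. (1 / bvnorm p m (\<lambda>_. 1 :: real^'n)) *\<^sub>R (1 :: real^'n)) = 1"
    using bvnorm_scale[OF p, of m "1 / bvnorm p m (\<lambda>_. 1 :: real^'n)" "\<lambda>_. 1 :: real^'n"] by simp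
  then show ?thesis by blast
qed

lemma bvnorm_bapply_le:
  assumes "1 \<le> p"
  shows "bvnorm p m (bapply m A v) \<le> bnorm p m A * bvnorm p m v"
proof -
  obtain C where C: "\<And>v. bvnorm p m (bapply m A v) \<le> C * bvnorm p m v"
    using bvnorm_bapply_bound[OF assms] by metis
  show ?thesis
  proof (cases "bvnorm p m v = 0")
    \<comment> \<open>A vector of norm zero cannot be normalised; here the crude bound shows that
      its image has norm zero as well.\<close>
    case True
    then show ?thesis using C[of v] by simp
  next
    case False
    define c where "c = bvnorm p m v"
    have c: "c > 0" using False bvnorm_nonneg[of p m v] by (simp add: c_def)
    have "bdd_above ((\<lambda>v. bvnorm p m (bapply m A v)) ` {v. bvnorm p m v = 1})"
      using C by (intro bdd_aboveI[of _ C]) (metis (mono_tags, lifting) imageE mem_Collect_eq mult.right_neutral)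
    moreover have "bvnorm p m (\<lambda>k. (1 / c) *\<^sub>R v k) = 1"
      using c bvnorm_scale[OF assms, of m "1 / c" v] by (simp add: c_def)
    ultimately have "bvnorm p m (bapply m A (\<lambda>k. (1 / c) *\<^sub>R v k)) \<le> bnorm p m A"
      unfolding bnorm_def by (intro cSUP_upper) auto
    then show ?thesis
      using c unfolding bapply_scale bvnorm_scale[OF assms] by (simp add: field_simps flip: c_def)
  qed
qed

lemma bnorm_le:
  fixes A :: "'n::finite bmat"
  assumes "1 \<le> p" "\<And>v. bvnorm p m v = 1 \<Longrightarrow> bvnorm p m (bapply m A v) \<le> C"
  shows "bnorm p m A \<le> C"
  unfolding bnorm_def using assms bvnorm_unit[OF assms(1)] by (intro cSUP_least) auto

lemma bnorm_nonneg:
  fixes A :: "'n::finite bmat"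
  assumes "1 \<le> p" shows "0 \<le> bnorm p m A"
  using bvnorm_unit[OF assms(1), where 'n='n] bvnorm_bapply_le[OF assms] bvnorm_nonneg
  by (metis mult.right_neutral order_trans)

text \<open>The difference quotient defining \<open>bmeasure\<close> is monotone in \<open>h\<close> by convexity, so its limit
  at 0 exists; otherwise \<open>Lim\<close> would be an unspecified value.\<close>

lemma bmeasure_lim:
  fixes A :: "'n::finite bmat"
  assumes p: "1 \<le> p"
  shows "((\<lambda>h. (bnorm p m (\<lambda>a b. bone a b + h *\<^sub>R A a b) - 1) / h) \<longlongrightarrow> bmeasure p m A) (at_right 0)"
proof -
  define Q where "Q h = (bnorm p m (\<lambda>a b. bone a b + h *\<^sub>R A a b) - 1) / h" for h
  have app: "bvnorm p m (bapply m (\<lambda>a b. bone a b + h *\<^sub>R A a b) v)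
      = bvnorm p m (\<lambda>k. v k + h *\<^sub>R bapply m A v k)" for h v
  proof (rule bvnorm_cong)
    fix k assume "k \<le> m"
    then have "bapply m bone v k = v k" by (rule bapply_bone)
    then show "bapply m (\<lambda>a b. bone a b + h *\<^sub>R A a b) v k = v k + h *\<^sub>R bapply m A v k"
      by (simp add: bapply_def matrix_vector_mult_add_rdistrib sum.distrib
          scaleR_matrix_vector_assoc[symmetric] scaleR_sum_right)
  qed
  have mono: "Q h \<le> Q k" if "0 < h" "h < k" for h k
  proof -
    have "bnorm p m (\<lambda>a b. bone a b + h *\<^sub>R A a b)
        \<le> (1 - h/k) + (h/k) * bnorm p m (\<lambda>a b. bone a b + k *\<^sub>R A a b)"
    proof (rule bnorm_le[OF p])
      fix v :: "'n bvec" assume v: "bvnorm p m v = 1"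
      have "bvnorm p m (\<lambda>i. v i + h *\<^sub>R bapply m A v i)
          = bvnorm p m (\<lambda>i. (1 - h/k) *\<^sub>R v i + (h/k) *\<^sub>R (v i + k *\<^sub>R bapply m A v i))"
        using that by (intro bvnorm_cong) (simp add: algebra_simps)
      also have "\<dots> \<le> (1 - h/k) * bvnorm p m v + (h/k) * bvnorm p m (\<lambda>i. v i + k *\<^sub>R bapply m A v i)"
        using bvnorm_triangle[OF p, of m "\<lambda>i. (1 - h/k) *\<^sub>R v i" "\<lambda>i. (h/k) *\<^sub>R (v i + k *\<^sub>R bapply m A v i)"] that
        unfolding bvnorm_scale[OF p] by simp
      also have "\<dots> \<le> (1 - h/k) + (h/k) * bnorm p m (\<lambda>a b. bone a b + k *\<^sub>R A a b)"
        using bvnorm_bapply_le[OF p, of m "\<lambda>a b. bone a b + k *\<^sub>R A a b" v] that v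
        unfolding app by (simp add: divide_right_mono mult_left_mono)
      finally show "bvnorm p m (bapply m (\<lambda>a b. bone a b + h *\<^sub>R A a b) v)
          \<le> (1 - h/k) + (h/k) * bnorm p m (\<lambda>a b. bone a b + k *\<^sub>R A a b)"
        unfolding app .
    qed
    then have "bnorm p m (\<lambda>a b. bone a b + h *\<^sub>R A a b) - 1 \<le> h * Q k"
      by (simp add: Q_def right_diff_distrib diff_divide_distrib)
    then show ?thesis using that by (simp add: Q_def[of h] pos_divide_le_eq mult.commute)
  qed
  \<comment> \<open>From \<open>|v| \<le> |v + h A v| + h |A v|\<close> at a unit vector. With this
    lower bound, the infimum over all positive h is a genuine one, and the monotone quotient tends
    to it.\<close>
  have lower: "- bnorm p m A \<le> Q h" if "0 < h" for h
  proof -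
    obtain v :: "'n bvec" where v: "bvnorm p m v = 1" using bvnorm_unit[OF p] by blast
    have "1 = bvnorm p m (\<lambda>i. (v i + h *\<^sub>R bapply m A v i) + (- h) *\<^sub>R bapply m A v i)"
      using v by simp
    also have "\<dots> \<le> bvnorm p m (\<lambda>i. v i + h *\<^sub>R bapply m A v i) + h * bvnorm p m (bapply m A v)"
      using bvnorm_triangle[OF p, of m "\<lambda>i. v i + h *\<^sub>R bapply m A v i" "\<lambda>i. (- h) *\<^sub>R bapply m A v i"] that
      unfolding bvnorm_scale[OF p] by simp
    also have "\<dots> \<le> bnorm p m (\<lambda>a b. bone a b + h *\<^sub>R A a b) + h * bnorm p m A"
      using bvnorm_bapply_le[OF p, of m "\<lambda>a b. bone a b + h *\<^sub>R A a b" v]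
        bvnorm_bapply_le[OF p, of m A v] that v
      unfolding app by (intro add_mono mult_left_mono) auto
    finally show ?thesis using that by (simp add: Q_def field_simps)
  qed
  have bdd: "bdd_below (Q ` {0<..})" using lower by (intro bdd_belowI[of _ "- bnorm p m A"]) auto
  have "(Q \<longlongrightarrow> Inf (Q ` {0<..})) (at_right 0)"
  proof (rule order_tendstoI)
    fix a assume "a < Inf (Q ` {0<..})"
    then show "eventually (\<lambda>h. a < Q h) (at_right 0)"
      using bdd by (auto intro!: eventually_at_right_less[THEN eventually_mono]
          elim!: less_le_trans intro: cINF_lower)
  next
    fix a assume "Inf (Q ` {0<..}) < a"
    then obtain k where k: "0 < k" "Q k < a"
      using cInf_less_iff[of "Q ` {0<..}" a] bdd by auto
    then show "eventually (\<lambda>h. Q h < a) (at_right 0)"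
      unfolding eventually_at_right_field using mono[of _ k] by (intro exI[of _ k]) force
  qed
  moreover from this have "bmeasure p m A = Inf (Q ` {0<..})"
    unfolding bmeasure_def Q_def[abs_def] by (intro tendsto_Lim) auto
  ultimately show ?thesis unfolding Q_def[abs_def] by simp
qed

text \<open>As \<phi> norms v, \<open>|v| + h \<phi> (A v) = \<phi> ((1 + h A) v) \<le> |1 + h A|
  |v|\<close>; subtracting |v|, dividing by h and letting h tend to 0 gives the measure. This
  replaces differentiating the norm.\<close>

lemma support_bmeasure:
  assumes p: "1 \<le> p"
    and eq: "bdot m \<phi> v = bvnorm p m v" and le: "\<And>u. bdot m \<phi> u \<le> bvnorm p m u"
  shows "bdot m \<phi> (bapply m A v) \<le> bmeasure p m A * bvnorm p m v"
proof (rule tendsto_lowerbound)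
  show "((\<lambda>h. (bnorm p m (\<lambda>a b. bone a b + h *\<^sub>R A a b) - 1) / h * bvnorm p m v)
      \<longlongrightarrow> bmeasure p m A * bvnorm p m v) (at_right 0)"
    by (intro tendsto_intros bmeasure_lim p)
  show "eventually (\<lambda>h. bdot m \<phi> (bapply m A v)
      \<le> (bnorm p m (\<lambda>a b. bone a b + h *\<^sub>R A a b) - 1) / h * bvnorm p m v) (at_right 0)"
    using eventually_at_right_less[of 0]
  proof eventually_elim
    case (elim h)
    have "bdot m \<phi> (bapply m (\<lambda>a b. bone a b + h *\<^sub>R A a b) v)
        = bdot m \<phi> (\<lambda>k. v k + h *\<^sub>R bapply m A v k)"
    proof (rule sum.cong)
      fix k assume "k \<in> {..m}"
      then have "bapply m bone v k = v k" by (simp add: bapply_bone)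
      then show "\<phi> k \<bullet> bapply m (\<lambda>a b. bone a b + h *\<^sub>R A a b) v k = \<phi> k \<bullet> (v k + h *\<^sub>R bapply m A v k)"
        by (simp add: bapply_def matrix_vector_mult_add_rdistrib sum.distrib
            scaleR_matrix_vector_assoc[symmetric] scaleR_sum_right)
    qed simp
    then have "bvnorm p m v + h * bdot m \<phi> (bapply m A v)
        \<le> bnorm p m (\<lambda>a b. bone a b + h *\<^sub>R A a b) * bvnorm p m v"
      using order_trans[OF le bvnorm_bapply_le[OF p, of m "\<lambda>a b. bone a b + h *\<^sub>R A a b" v]]
      by (simp add: inner_add_right sum.distrib sum_distrib_left flip: eq)
    then show ?case using elim by (simp add: field_simps)
  qed
qed simp

lemma support_bnorm:
  assumes p: "1 \<le> p" and le: "\<And>u. bdot m \<phi> u \<le> bvnorm p m u"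
  shows "bdot m \<phi> (bapply m A v) \<le> bnorm p m A * bvnorm p m v"
  using le bvnorm_bapply_le[OF p] by (rule order_trans)

section \<open>The bidiagonal transformation and its inverse\<close>

lemma Tbar_inverse:
  "\<exists>B :: 'n::finite bmat. \<forall>a\<le>m. \<forall>b\<le>m.
     bmult m (Tbar \<alpha>) B a b = bone a b \<and> bmult m B (Tbar \<alpha>) a b = bone a b"
proof -
  \<comment> \<open>The Neumann series of a unipotent bidiagonal matrix: each entry above the
    diagonal is a single product. \<open>rowexp\<close> and \<open>colexp\<close> are the equations
    for a right and a left inverse, read entrywise.\<close>
  define \<beta> where "\<beta> a b = (if a \<le> b then (\<Prod>k\<in>{a<..b}. - \<alpha> k) else 0)" for a b
  define B :: "'n bmat" where "B a b = \<beta> a b *\<^sub>R mat 1" for a b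
  have T: "Tbar \<alpha> a b = (if b = a then mat 1 else 0) + (if b = Suc a then \<alpha> b *\<^sub>R mat 1 else 0 :: real^'n^'n)"
    for a b by (simp add: Tbar_def)
  have rowexp: "\<beta> a b = (if a = b then 1 else 0) - \<alpha> (Suc a) * \<beta> (Suc a) b" for a b
  proof (cases "a < b")
    case True
    then have "{a<..b} = insert (Suc a) {Suc a<..b}" by auto
    then show ?thesis using True by (simp add: \<beta>_def)
  qed (auto simp: \<beta>_def)
  have colexp: "\<beta> a (Suc b) = (if a = Suc b then 1 else 0) - \<beta> a b * \<alpha> (Suc b)" for a b
  proof (cases "a \<le> b")
    case True
    then have "{a<..Suc b} = insert (Suc b) {a<..b}" by auto
    then show ?thesis using True by (simp add: \<beta>_def)
  qed (auto simp: \<beta>_def)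
  have zero: "\<beta> a 0 = (if a = 0 then 1 else 0)" for a by (simp add: \<beta>_def)
  have sc: "(c *\<^sub>R mat 1) ** (d *\<^sub>R mat 1) = (c * d) *\<^sub>R (mat 1 :: real^'n^'n)" for c d
    by (simp add: matrix_scalar_ac mult.commute flip: scalar_matrix_assoc)
  show ?thesis
  proof (intro exI allI impI conjI)
    fix a b assume ab: "a \<le> m" "b \<le> m"
    have "bmult m (Tbar \<alpha>) B a b
        = (\<Sum>c\<le>m. (if c = a then B c b else 0) + (if c = Suc a then \<alpha> c *\<^sub>R B c b else 0))"
      unfolding bmult_def T B_def
      by (intro sum.cong refl) (auto simp: sc)
    also have "\<dots> = B a b + (if Suc a \<le> m then \<alpha> (Suc a) *\<^sub>R B (Suc a) b else 0)"
      using ab by (simp add: sum.distrib)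
    \<comment> \<open>For a = m the missing summand is zero anyway: as \<open>b \<le> m\<close>,
      block (m + 1, b) lies below the diagonal.\<close>
    also have "\<dots> = B a b + \<alpha> (Suc a) *\<^sub>R B (Suc a) b"
      using ab by (auto simp: B_def \<beta>_def)
    also have "\<dots> = bone a b"
      using rowexp[of a b] by (simp add: B_def bone_def flip: scaleR_add_left)
    finally show "bmult m (Tbar \<alpha>) B a b = bone a b" .
    have "bmult m B (Tbar \<alpha>) a b
        = (\<Sum>c\<le>m. (if c = b then B a c else 0) + (if b = Suc c then \<alpha> b *\<^sub>R B a c else 0))"
      unfolding bmult_def T B_def
      by (intro sum.cong refl) (auto simp: sc)
    also have "\<dots> = B a b + (case b of 0 \<Rightarrow> 0 | Suc c \<Rightarrow> \<alpha> b *\<^sub>R B a c)"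
      using ab by (cases b) (simp_all add: sum.distrib)
    also have "\<dots> = bone a b"
      using colexp[of a "b - 1"] zero[of a]
      by (cases b) (simp_all add: B_def bone_def mult.commute flip: scaleR_add_left)
    finally show "bmult m B (Tbar \<alpha>) a b = bone a b" .
  qed
qed

text \<open>\<open>binv\<close> is a choice, meaningful because the explicit inverse exists; it is
  constrained only on block indices up to m, whence the restriction on k.\<close>

lemma binv_Tbar:
  fixes \<alpha> :: "nat \<Rightarrow> real"
  defines "T \<equiv> Tbar \<alpha> :: 'n::finite bmat"
  assumes "k \<le> m"
  shows "bapply m (binv m T) (bapply m T v) k = v k"
proof -
  have "bmult m (binv m T) T a b = bone a b" if "a \<le> m" "b \<le> m" for a b
    using someI_ex[OF Tbar_inverse[of m \<alpha>, where 'n='n]] that unfolding binv_def T_def by blast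
  then have "bapply m (bmult m (binv m T) T) v k = bapply m bone v k"
    using assms by (simp add: bapply_def)
  then show ?thesis using assms by (simp add: bapply_bmult bapply_bone)
qed

text \<open>This is how (C2) and (C3), stated for conjugated matrices, become bounds on T A v in
  terms of |T v|. It holds at every index because \<open>bapply\<close> reads only the blocks up to
  m of its argument.\<close>

lemma bapply_bconj_Tbar:
  "bapply m (bconj m (Tbar \<alpha>) A) (bapply m (Tbar \<alpha>) v) = bapply m (Tbar \<alpha>) (bapply m A v)"
  unfolding bconj_def bapply_bmult
  by (intro arg_cong[where f="bapply m (Tbar \<alpha>)"] bapply_cong binv_Tbar)

text \<open>Needed for gains that increase strictly. In fact the condition number is at least 1, as
  the inverse of T times T fixes a unit vector.\<close>

lemma bcond_Tbar_pos:
  assumes p: "1 \<le> p"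
  shows "0 < bcond p m (Tbar \<alpha> :: 'n::finite bmat)"
proof -
  let ?T = "Tbar \<alpha> :: 'n bmat"
  obtain v :: "'n bvec" where v: "bvnorm p m v = 1" using bvnorm_unit[OF p] by blast
  have "1 = bvnorm p m (bapply m (binv m ?T) (bapply m ?T v))"
    unfolding v[symmetric] by (intro bvnorm_cong) (simp add: binv_Tbar)
  also have "\<dots> \<le> bnorm p m (binv m ?T) * bvnorm p m (bapply m ?T v)"
    by (rule bvnorm_bapply_le[OF p])
  also have "\<dots> \<le> bnorm p m (binv m ?T) * bnorm p m ?T"
    using bvnorm_bapply_le[OF p, of m ?T v] v by (intro mult_left_mono bnorm_nonneg p) auto
  finally show ?thesis unfolding bcond_def by (simp add: mult.commute)
qed

lemma continuous_on_bvnorm: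
  fixes v :: "'t::t2_space \<Rightarrow> nat \<Rightarrow> real^'n"
  assumes p: "1 \<le> p" and v: "\<And>k. k \<le> m \<Longrightarrow> continuous_on A (\<lambda>t. v t k)"
  shows "continuous_on A (\<lambda>t. bvnorm p m (v t))"
  unfolding continuous_on_def
proof
  fix t assume t: "t \<in> A"
  have diff: "bvnorm p m u - bvnorm p m v \<le> (\<Sum>k\<le>m. real CARD('n) * norm (u k - v k))"
    for u v :: "nat \<Rightarrow> real^'n"
  proof -
    have "bvnorm p m u - bvnorm p m v \<le> bvnorm p m (\<lambda>k. u k - v k)"
      using bvnorm_triangle[OF p, of m "\<lambda>k. u k - v k" v] by simp
    also have "\<dots> \<le> (\<Sum>k\<le>m. vnorm p (u k - v k))" by (rule bvnorm_le_sum[OF p])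
    also have "\<dots> \<le> (\<Sum>k\<le>m. real CARD('n) * norm (u k - v k))" by (intro sum_mono vnorm_le p)
    finally show ?thesis .
  qed
  have "((\<lambda>s. norm (v s k - v t k)) \<longlongrightarrow> 0) (at t within A)" if "k \<le> m" for k
    using v[OF that] t unfolding continuous_on_def by (intro tendsto_norm_zero) (simp add: LIM_zero)
  then have "((\<lambda>s. \<Sum>k\<le>m. real CARD('n) * norm (v s k - v t k)) \<longlongrightarrow> 0) (at t within A)"
    by (intro tendsto_null_sum tendsto_mult_right_zero) auto
  moreover have "\<bar>bvnorm p m (v s) - bvnorm p m (v t)\<bar>
      \<le> (\<Sum>k\<le>m. real CARD('n) * norm (v s k - v t k))" for s
    using diff[of "v s" "v t"] diff[of "v t" "v s"] by (simp add: norm_minus_commute abs_le_iff)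
  ultimately have "((\<lambda>s. bvnorm p m (v s) - bvnorm p m (v t)) \<longlongrightarrow> 0) (at t within A)"
    by (intro Lim_null_comparison[where f="\<lambda>s. bvnorm p m (v s) - bvnorm p m (v t)"]) auto
  then show "((\<lambda>s. bvnorm p m (v s)) \<longlongrightarrow> bvnorm p m (v t)) (at t within A)"
    by (rule LIM_zero_cancel)
qed

lemma vnorm_eq_bvnorm: "1 \<le> p \<Longrightarrow> vnorm p v = bvnorm p 0 (\<lambda>_. v)"
  using bvnorm_single[of p 0 0 v] bvnorm_cong[of 0 "\<lambda>j. if j = 0 then v else 0" "\<lambda>_. v" p] by simp

lemma continuous_on_vnorm:
  fixes v :: "'t::t2_space \<Rightarrow> real^'n"
  assumes "1 \<le> p" "continuous_on A v"
  shows "continuous_on A (\<lambda>t. vnorm p (v t))"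
  unfolding vnorm_eq_bvnorm[OF assms(1)] by (intro continuous_on_bvnorm assms)

lemma bdot_bapply_add:
  "bdot m \<phi> (bapply m A (\<lambda>k. u k + v k)) = bdot m \<phi> (bapply m A u) + bdot m \<phi> (bapply m A v)"
  by (simp add: bapply_add inner_add_right sum.distrib)

lemma bdot_bapply_sum:
  "bdot m \<phi> (bapply m A (\<lambda>k. \<Sum>j\<in>J. u j k)) = (\<Sum>j\<in>J. bdot m \<phi> (bapply m A (u j)))"
  unfolding bapply_sum inner_sum_right by (rule sum.swap)

lemma bdot_bapply_diff:
  "bdot m \<phi> (bapply m A (\<lambda>k. u k - v k)) = bdot m \<phi> (bapply m A u) - bdot m \<phi> (bapply m A v)"
  using bdot_bapply_add[of \<phi> m A "\<lambda>k. u k - v k" v] by simp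

lemma has_real_derivative_bdot_bapply:
  assumes "\<And>k. k \<le> m \<Longrightarrow> ((\<lambda>s. g s k) has_vector_derivative g' k) (at t)"
  shows "((\<lambda>s. bdot m \<phi> (bapply m A (g s))) has_real_derivative bdot m \<phi> (bapply m A g')) (at t)"
  unfolding has_real_derivative_iff_has_vector_derivative bapply_def
  by (intro has_vector_derivative_sum bounded_linear.has_vector_derivative[OF bounded_linear_inner_right]
      bounded_linear.has_vector_derivative[OF matrix_vector_mul_bounded_linear]) (use assms in auto)

section \<open>Jacobians of smooth couplings\<close>

text \<open>The coordinates are switched on one at a time, with a one-variable mean value theorem at
  each switch. Every partial derivative gets its own point, but the bound by
  \<open>\<bar>c l\<bar>\<close> forces all these points to the base point as c tends to 0.\<close>

lemma partials_increment:
  fixes \<Phi> :: "('k \<Rightarrow> real) \<Rightarrow> real"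
  assumes "finite K"
    and der: "\<And>k c. k \<in> K \<Longrightarrow> ((\<lambda>s. \<Phi> (c(k := c k + s))) has_real_derivative G k c) (at 0)"
  shows "\<exists>\<xi>. \<Phi> (\<lambda>k. if k \<in> K then c k else 0) - \<Phi> (\<lambda>_. 0) = (\<Sum>k\<in>K. c k * G k (\<xi> k))
    \<and> (\<forall>k l. \<bar>\<xi> k l\<bar> \<le> \<bar>c l\<bar>)"
  using assms
proof (induction K rule: finite_induct)
  case empty
  then show ?case by (auto intro: exI[of _ "\<lambda>_ _. 0"])
next
  case (insert k K)
  define cK where "cK = (\<lambda>k. if k \<in> K then c k else 0)"
  obtain \<xi> where \<xi>: "\<Phi> cK - \<Phi> (\<lambda>_. 0) = (\<Sum>k\<in>K. c k * G k (\<xi> k))" "\<And>k l. \<bar>\<xi> k l\<bar> \<le> \<bar>c l\<bar>"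
    using insert unfolding cK_def by force
  define g where "g s = \<Phi> (cK(k := s))" for s
  have g: "(g has_real_derivative G k (cK(k := s))) (at s)" for s
  proof -
    have "((\<lambda>r. g (s + r)) has_real_derivative G k (cK(k := s))) (at 0)"
      using insert.prems[OF insertI1, of "cK(k := s)"] unfolding g_def fun_upd_upd fun_upd_same .
    then show ?thesis using DERIV_shift[of g _ 0 s] by (simp add: add.commute)
  qed
  have "\<exists>z. \<bar>z\<bar> \<le> \<bar>x\<bar> \<and> g x - g 0 = x * G k (cK(k := z))" for x
  proof (cases x "0 :: real" rule: linorder_cases)
    case less
    then obtain z where "x < z" "z < 0" "g 0 - g x = (0 - x) * G k (cK(k := z))"
      using MVT2[of x 0 g "\<lambda>z. G k (cK(k := z))"] g by blast
    then show ?thesis by (intro exI[of _ z]) auto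
  next
    case greater
    then obtain z where "0 < z" "z < x" "g x - g 0 = (x - 0) * G k (cK(k := z))"
      using MVT2[of 0 x g "\<lambda>z. G k (cK(k := z))"] g by blast
    then show ?thesis by (intro exI[of _ z]) auto
  qed auto
  then obtain z where z: "\<bar>z\<bar> \<le> \<bar>c k\<bar>" "g (c k) - g 0 = c k * G k (cK(k := z))" by blast
  have g0: "g 0 = \<Phi> cK" using insert.hyps by (simp add: g_def cK_def fun_upd_idem)
  have gk: "g (c k) = \<Phi> (\<lambda>l. if l \<in> insert k K then c l else 0)"
    unfolding g_def by (rule arg_cong[where f=\<Phi>]) (auto simp: cK_def)
  have "(\<Sum>l\<in>K. c l * G l ((\<xi>(k := cK(k := z))) l)) = (\<Sum>l\<in>K. c l * G l (\<xi> l))"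
    using insert.hyps by (intro sum.cong) auto
  then have "\<Phi> (\<lambda>l. if l \<in> insert k K then c l else 0) - \<Phi> (\<lambda>_. 0)
      = (\<Sum>l\<in>insert k K. c l * G l ((\<xi>(k := cK(k := z))) l))"
    using insert.hyps \<xi>(1) z(2) g0 gk by simp
  moreover have "\<bar>(\<xi>(k := cK(k := z))) i l\<bar> \<le> \<bar>c l\<bar>" for i l
    using \<xi>(2) z(1) by (auto simp: cK_def)
  ultimately show ?case by blast
qed

lemma tendsto_fun:
  fixes f :: "'u \<Rightarrow> 'j \<Rightarrow> 'a::topological_space"
  assumes "\<And>j. ((\<lambda>u. f u j) \<longlongrightarrow> l j) F"
  shows "(f \<longlongrightarrow> l) F"
  using assms limitin_componentwise[where X="\<lambda>_. euclidean" and I=UNIV and f=f and l=l and F=F]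
  by (simp add: euclidean_product_topology)

text \<open>A smooth function at a frozen time. Linearity of \<open>D j v X\<close> in v is not
  assumed; it comes out when D is identified with a Jacobian.\<close>

locale continuous_partials =
  fixes f :: "('j \<Rightarrow> 'a::euclidean_space) \<Rightarrow> 'b::euclidean_space" and D :: "'j \<Rightarrow> 'a \<Rightarrow> ('j \<Rightarrow> 'a) \<Rightarrow> 'b"
  assumes der: "\<And>j v X. ((\<lambda>s. f (X(j := X j + s *\<^sub>R v))) has_vector_derivative D j v X) (at 0)"
    and cont: "\<And>j v. continuous_on UNIV (D j v)"
begin

lemma der_inner:
  "((\<lambda>s. f (X(j := X j + s *\<^sub>R v)) \<bullet> i) has_real_derivative D j v X \<bullet> i) (at 0)"
  unfolding has_real_derivative_iff_has_vector_derivative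
  by (rule bounded_linear.has_vector_derivative[OF bounded_linear_inner_left der])

lemma tendsto_D:
  "(\<And>k. ((\<lambda>u. Y u k) \<longlongrightarrow> X k) F) \<Longrightarrow> ((\<lambda>u. D j v (Y u)) \<longlongrightarrow> D j v X) F"
  by (rule continuous_on_tendsto_compose[OF cont tendsto_fun]) auto

text \<open>Continuous partials give a Frechet derivative, without which \<open>jacobian\<close>
  would be an unspecified matrix. Since each coordinate of u is at most |u|, the remainder divided
  by |u| is bounded by the increments of the partials between X and points tending to X.\<close>

lemma has_derivative_state:
  "((\<lambda>y. f (X(j := y))) has_derivative (\<lambda>u. \<Sum>b\<in>Basis. (u \<bullet> b) *\<^sub>R D j b X)) (at (X j))"
proof (subst has_derivative_componentwise_within, rule ballI)
  fix i :: 'b assume i: "i \<in> Basis"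
  define P where "P c = X(j := X j + (\<Sum>b\<in>Basis. c b *\<^sub>R b))" for c :: "'a \<Rightarrow> real"
  have upd: "P (c(b := c b + s)) = (P c)(j := P c j + s *\<^sub>R b)" if "b \<in> Basis" for c b s
  proof -
    have "(\<Sum>e\<in>Basis. (c(b := c b + s)) e *\<^sub>R e) = (\<Sum>e\<in>Basis. c e *\<^sub>R e + (if e = b then s *\<^sub>R b else 0))"
      by (intro sum.cong) (auto simp: scaleR_add_left)
    then show ?thesis using that by (simp add: P_def sum.distrib add.assoc)
  qed
  have "\<exists>\<xi>. f (X(j := X j + u)) \<bullet> i - f X \<bullet> i = (\<Sum>b\<in>Basis. (u \<bullet> b) * (D j b (P (\<xi> b)) \<bullet> i))
      \<and> (\<forall>b e. \<bar>\<xi> b e\<bar> \<le> \<bar>u \<bullet> e\<bar>)" for u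
  proof -
    have "\<And>k c. k \<in> Basis \<Longrightarrow> ((\<lambda>s. f (P (c(k := c k + s))) \<bullet> i) has_real_derivative D j k (P c) \<bullet> i) (at 0)"
      by (simp add: upd der_inner)
    from partials_increment[where \<Phi>="\<lambda>c. f (P c) \<bullet> i" and G="\<lambda>b c. D j b (P c) \<bullet> i"
        and c="\<lambda>b. u \<bullet> b", OF finite_Basis this]
    have "\<exists>\<xi>. f (P (\<lambda>b. if b \<in> Basis then u \<bullet> b else 0)) \<bullet> i - f (P (\<lambda>_. 0)) \<bullet> i
        = (\<Sum>b\<in>Basis. (u \<bullet> b) * (D j b (P (\<xi> b)) \<bullet> i)) \<and> (\<forall>b e. \<bar>\<xi> b e\<bar> \<le> \<bar>u \<bullet> e\<bar>)" .
    moreover have "P (\<lambda>b. if b \<in> Basis then u \<bullet> b else 0) = X(j := X j + u)" "P (\<lambda>_. 0) = X"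
      by (simp_all add: P_def euclidean_representation)
    ultimately show ?thesis by (simp only:)
  qed
  from choice[OF allI, OF this] obtain \<xi> where
    "\<forall>u. f (X(j := X j + u)) \<bullet> i - f X \<bullet> i = (\<Sum>b\<in>Basis. (u \<bullet> b) * (D j b (P (\<xi> u b)) \<bullet> i))
      \<and> (\<forall>b e. \<bar>\<xi> u b e\<bar> \<le> \<bar>u \<bullet> e\<bar>)" ..
  then have \<xi>: "\<And>u. f (X(j := X j + u)) \<bullet> i - f X \<bullet> i = (\<Sum>b\<in>Basis. (u \<bullet> b) * (D j b (P (\<xi> u b)) \<bullet> i))"
    "\<And>u b e. \<bar>\<xi> u b e\<bar> \<le> \<bar>u \<bullet> e\<bar>"
    by blast+
  have "((\<lambda>u. \<xi> u b e) \<longlongrightarrow> 0) (at 0)" for b e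
  proof (rule Lim_null_comparison)
    show "((\<lambda>u :: 'a. \<bar>u \<bullet> e\<bar>) \<longlongrightarrow> 0) (at 0)"
      using tendsto_rabs_zero[of "\<lambda>u. u \<bullet> e"] tendsto_inner[OF tendsto_ident_at[of 0 UNIV] tendsto_const[of e]]
      by simp
  qed (simp add: \<xi>(2))
  then have "((\<lambda>u. X j + (\<Sum>e\<in>Basis. \<xi> u b e *\<^sub>R e)) \<longlongrightarrow> X j + (\<Sum>e\<in>Basis. 0 *\<^sub>R e)) (at 0)" for b
    by (intro tendsto_intros)
  then have "((\<lambda>u. P (\<xi> u b) k) \<longlongrightarrow> X k) (at 0)" for b k
    by (cases "k = j") (simp_all add: P_def)
  then have "((\<lambda>u. D j b (P (\<xi> u b)) \<bullet> i) \<longlongrightarrow> D j b X \<bullet> i) (at 0)" for b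
    by (intro tendsto_intros tendsto_D)
  then have lim: "((\<lambda>u. \<Sum>b\<in>Basis. \<bar>D j b (P (\<xi> u b)) \<bullet> i - D j b X \<bullet> i\<bar>) \<longlongrightarrow> 0) (at 0)"
    by (intro tendsto_null_sum tendsto_rabs_zero) (simp add: LIM_zero)
  have bl: "bounded_linear (\<lambda>u. (\<Sum>b\<in>Basis. (u \<bullet> b) *\<^sub>R D j b X) \<bullet> i)"
    by (intro bounded_linear_intros)
  have "((\<lambda>u. norm (f (X(j := X j + u)) \<bullet> i - f X \<bullet> i - (\<Sum>b\<in>Basis. (u \<bullet> b) *\<^sub>R D j b X) \<bullet> i) / norm u) \<longlongrightarrow> 0) (at 0)"
  proof (rule Lim_null_comparison[OF _ lim], rule always_eventually, rule allI)
    fix u :: 'a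
    have "norm (f (X(j := X j + u)) \<bullet> i - f X \<bullet> i - (\<Sum>b\<in>Basis. (u \<bullet> b) *\<^sub>R D j b X) \<bullet> i)
        = \<bar>\<Sum>b\<in>Basis. (u \<bullet> b) * (D j b (P (\<xi> u b)) \<bullet> i - D j b X \<bullet> i)\<bar>"
      by (simp add: \<xi>(1) inner_sum_left right_diff_distrib sum_subtractf)
    also have "\<dots> \<le> (\<Sum>b\<in>Basis. norm u * \<bar>D j b (P (\<xi> u b)) \<bullet> i - D j b X \<bullet> i\<bar>)"
      by (rule order_trans[OF sum_abs], rule sum_mono)
         (auto simp: abs_mult intro!: mult_right_mono Basis_le_norm)
    finally show "norm (norm (f (X(j := X j + u)) \<bullet> i - f X \<bullet> i - (\<Sum>b\<in>Basis. (u \<bullet> b) *\<^sub>R D j b X) \<bullet> i) / norm u)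
        \<le> (\<Sum>b\<in>Basis. \<bar>D j b (P (\<xi> u b)) \<bullet> i - D j b X \<bullet> i\<bar>)"
      by (cases "u = 0") (simp_all add: sum_nonneg pos_divide_le_eq mult.commute flip: sum_distrib_left)
  qed
  with bl show "((\<lambda>y. f (X(j := y)) \<bullet> i) has_derivative (\<lambda>u. (\<Sum>b\<in>Basis. (u \<bullet> b) *\<^sub>R D j b X) \<bullet> i)) (at (X j))"
    unfolding has_derivative_at by simp
qed

text \<open>Several arguments move at once: the coordinates of the increment lemma are now the step
  lengths along the directions \<open>E j\<close>, all equal to s.\<close>

lemma has_vector_derivative_line:
  assumes J: "finite J"
  shows "((\<lambda>s. f (\<lambda>j. if j \<in> J then X j + s *\<^sub>R E j else X j)) has_vector_derivative (\<Sum>j\<in>J. D j (E j) X)) (at 0)"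
  unfolding has_vector_derivative_def
proof (subst has_derivative_componentwise_within, rule ballI)
  fix i :: 'b assume i: "i \<in> Basis"
  define P where "P c = (\<lambda>j. if j \<in> J then X j + c j *\<^sub>R E j else X j)" for c :: "'j \<Rightarrow> real"
  have upd: "P (c(j := c j + s)) = (P c)(j := P c j + s *\<^sub>R E j)" if "j \<in> J" for c j s
    using that by (auto simp: P_def scaleR_add_left)
  have P0: "P (\<lambda>_. 0) = X" by (auto simp: P_def)
  have PJ: "P (\<lambda>k. if k \<in> J then s else 0) = P (\<lambda>_. s)" for s by (auto simp: P_def)
  have "\<exists>\<xi>. f (P (\<lambda>_. s)) \<bullet> i - f X \<bullet> i = (\<Sum>j\<in>J. s * (D j (E j) (P (\<xi> j)) \<bullet> i))
      \<and> (\<forall>j k. \<bar>\<xi> j k\<bar> \<le> \<bar>s\<bar>)" for s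
  proof -
    have "\<And>k c. k \<in> J \<Longrightarrow> ((\<lambda>s. f (P (c(k := c k + s))) \<bullet> i) has_real_derivative D k (E k) (P c) \<bullet> i) (at 0)"
      by (simp add: upd der_inner)
    from partials_increment[OF J this, where c="\<lambda>_. s"] show ?thesis by (simp add: P0 PJ)
  qed
  from choice[OF allI, OF this] obtain \<xi> where
    "\<forall>s. f (P (\<lambda>_. s)) \<bullet> i - f X \<bullet> i = (\<Sum>j\<in>J. s * (D j (E j) (P (\<xi> s j)) \<bullet> i))
      \<and> (\<forall>j k. \<bar>\<xi> s j k\<bar> \<le> \<bar>s\<bar>)" ..
  then have \<xi>: "\<And>s. f (P (\<lambda>_. s)) \<bullet> i - f X \<bullet> i = (\<Sum>j\<in>J. s * (D j (E j) (P (\<xi> s j)) \<bullet> i))"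
    "\<And>s j k. \<bar>\<xi> s j k\<bar> \<le> \<bar>s\<bar>"
    by blast+
  have "((\<lambda>s. \<xi> s j k) \<longlongrightarrow> 0) (at 0)" for j k
  proof (rule Lim_null_comparison)
    show "((\<lambda>s :: real. \<bar>s\<bar>) \<longlongrightarrow> 0) (at 0)" by (rule tendsto_rabs_zero[OF tendsto_ident_at])
  qed (simp add: \<xi>(2))
  then have "((\<lambda>s. X k + \<xi> s j k *\<^sub>R E k) \<longlongrightarrow> X k + 0 *\<^sub>R E k) (at 0)" for j k
    by (intro tendsto_intros)
  then have "((\<lambda>s. P (\<xi> s j) k) \<longlongrightarrow> X k) (at 0)" for j k
    by (cases "k \<in> J") (simp_all add: P_def)
  then have lim: "((\<lambda>s. \<Sum>j\<in>J. D j (E j) (P (\<xi> s j)) \<bullet> i) \<longlongrightarrow> (\<Sum>j\<in>J. D j (E j) X) \<bullet> i) (at 0)"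
    unfolding inner_sum_left by (intro tendsto_intros tendsto_D)
  have "((\<lambda>s. (f (P (\<lambda>_. s)) \<bullet> i - f (P (\<lambda>_. 0)) \<bullet> i) / (s - 0)) \<longlongrightarrow> (\<Sum>j\<in>J. D j (E j) X) \<bullet> i) (at 0)"
  proof (rule Lim_transform_eventually[OF lim])
    show "\<forall>\<^sub>F s in at 0. (\<Sum>j\<in>J. D j (E j) (P (\<xi> s j)) \<bullet> i)
        = (f (P (\<lambda>_. s)) \<bullet> i - f (P (\<lambda>_. 0)) \<bullet> i) / (s - 0)"
      unfolding P0 \<xi>(1) by (simp add: eventually_at_filter flip: sum_distrib_left)
  qed
  then have "((\<lambda>s. f (P (\<lambda>_. s)) \<bullet> i) has_real_derivative (\<Sum>j\<in>J. D j (E j) X) \<bullet> i) (at 0)"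
    unfolding has_field_derivative_iff .
  then show "((\<lambda>s. f (\<lambda>j. if j \<in> J then X j + s *\<^sub>R E j else X j) \<bullet> i)
      has_derivative (\<lambda>x. (x *\<^sub>R (\<Sum>j\<in>J. D j (E j) X)) \<bullet> i)) (at 0)"
    unfolding has_field_derivative_def P_def by (simp add: mult_commute_abs)
qed

end

text \<open>The directional partials provided by \<open>smooth\<close> are Jacobians by uniqueness
  of derivatives; the derivative at s is the one at 0 of the segment based at
  \<open>P s\<close>.\<close>

lemma smooth_has_vector_derivative_line:
  fixes F :: "('j \<Rightarrow> real^'n) \<Rightarrow> real \<Rightarrow> real^'k" and X E :: "'j \<Rightarrow> real^'n"
  assumes F: "smooth F" and t: "0 \<le> t" and J: "finite J"
  defines "P \<equiv> \<lambda>s. \<lambda>j. if j \<in> J then X j + s *\<^sub>R E j else X j"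
  shows "((\<lambda>s. F (P s) t) has_vector_derivative
     (\<Sum>j\<in>J. jacobian (\<lambda>y. F ((P s)(j := y)) t) (at (P s j)) *v E j)) (at s)"
proof -
  have "times_differentiable (Suc 0) F" using F unfolding smooth_def by blast
  then have "\<forall>j v. \<exists>G. continuous_on (UNIV \<times> {0..}) (\<lambda>(X, t). G X t) \<and>
        (\<forall>X. \<forall>t\<ge>0. ((\<lambda>s. F (X(j := X j + s *\<^sub>R v)) t) has_vector_derivative G X t) (at 0))"
    by simp
  then obtain D where D: "\<And>j v. continuous_on (UNIV \<times> {0..}) (\<lambda>(X, t). D j v X t)"
    "\<And>j v X t. t \<ge> 0 \<Longrightarrow> ((\<lambda>s. F (X(j := X j + s *\<^sub>R v)) t) has_vector_derivative D j v X t) (at 0)"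
    by metis
  interpret continuous_partials "\<lambda>X. F X t" "\<lambda>j v X. D j v X t"
  proof
    show "continuous_on UNIV (\<lambda>X. D j v X t)" for j v
      using continuous_on_compose2[OF D(1)[of j v]
          continuous_on_Pair[OF continuous_on_id continuous_on_const[of UNIV t]]] t
      by auto
  qed (use D t in auto)
  have jac: "D j v X t = jacobian (\<lambda>y. F (X(j := y)) t) (at (X j)) *v v" for j v X
  proof -
    have "(\<lambda>y. F (X(j := y)) t) differentiable (at (X j))"
      using has_derivative_state by (auto simp: differentiable_def)
    then have "((\<lambda>y. F (X(j := y)) t) has_derivative (*v) (jacobian (\<lambda>y. F (X(j := y)) t) (at (X j))))
        (at (X j + 0 *\<^sub>R v))"
      unfolding jacobian_works by simp
    moreover have "((\<lambda>s. X j + s *\<^sub>R v) has_derivative (\<lambda>s. s *\<^sub>R v)) (at 0)"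
      by (auto intro!: derivative_eq_intros)
    ultimately have "((\<lambda>s. F (X(j := X j + s *\<^sub>R v)) t) has_derivative
        (\<lambda>s. jacobian (\<lambda>y. F (X(j := y)) t) (at (X j)) *v (s *\<^sub>R v))) (at 0)"
      using has_derivative_compose by fastforce
    then have "((\<lambda>s. F (X(j := X j + s *\<^sub>R v)) t) has_vector_derivative
        jacobian (\<lambda>y. F (X(j := y)) t) (at (X j)) *v v) (at 0)"
      by (simp add: has_vector_derivative_def matrix_vector_mult_scaleR)
    then show ?thesis using der vector_derivative_unique_at by blast
  qed
  have "((\<lambda>r. F (\<lambda>j. if j \<in> J then P s j + r *\<^sub>R E j else P s j) t) has_vector_derivative
      (\<Sum>j\<in>J. D j (E j) (P s) t)) (at 0)"
    by (rule has_vector_derivative_line[OF J])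
  moreover have "(\<lambda>j. if j \<in> J then P s j + r *\<^sub>R E j else P s j) = P (s + r)" for r
    by (auto simp: P_def scaleR_add_left)
  ultimately have "((\<lambda>r. F (P (s + r)) t) has_vector_derivative (\<Sum>j\<in>J. D j (E j) (P s) t)) (at (s - s))"
    by simp
  then have "(((\<lambda>r. F (P (s + r)) t) \<circ> (\<lambda>u. u - s)) has_vector_derivative
      1 *\<^sub>R (\<Sum>j\<in>J. D j (E j) (P s) t)) (at s)"
    by (intro vector_diff_chain_at) (auto intro!: derivative_eq_intros)
  then show ?thesis by (simp add: o_def jac)
qed

text \<open>States and leader values form one family over \<open>nat + nat\<close>, of which only
  the components \<open>Inl j\<close> move. The set I may be larger than the neighbourhood, to match
  the sums over all agents in (C2) and (C3).\<close>

lemma coupling_derivative: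
  fixes h :: "(nat \<Rightarrow> real^'n) \<Rightarrow> (nat \<Rightarrow> real^'n) \<Rightarrow> real \<Rightarrow> real^'n::finite"
    and X E :: "nat \<Rightarrow> real^'n"
  assumes "smooth_coupling J L h" "0 \<le> t" "finite I"
  defines "P \<equiv> \<lambda>s. \<lambda>j. if j \<in> I then X j + s *\<^sub>R E j else X j"
  shows "((\<lambda>s. h (P s) z t) has_vector_derivative (\<Sum>j\<in>I. d_state h j (P s) z t *v E j)) (at s)"
proof -
  define F where "F X t = h (\<lambda>j. X (Inl j)) (\<lambda>l. X (Inr l)) t" for X :: "nat + nat \<Rightarrow> real^'n" and t
  have "smooth F" using assms unfolding smooth_coupling_def F_def[abs_def] by blast
  note der = smooth_has_vector_derivative_line[OF this assms(2), of "Inl ` I" "case_sum X z" "case_sum E z" s]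
  define Q where "Q s j = (if j \<in> Inl ` I then case_sum X z j + s *\<^sub>R case_sum E z j else case_sum X z j)"
    for s :: real and j :: "nat + nat"
  have Q: "Q s (Inl j) = P s j" "Q s (Inr j) = z j" for s j
    by (auto simp: Q_def P_def)
  have upd: "F ((Q s)(Inl j := y)) t = h ((P s)(j := y)) z t" for s j y
    unfolding F_def by (intro arg_cong2[where f="\<lambda>x z. h x z t"]) (auto simp: Q fun_eq_iff)
  have "((\<lambda>s. F (Q s) t) has_vector_derivative
      (\<Sum>j\<in>Inl ` I. jacobian (\<lambda>y. F ((Q s)(j := y)) t) (at (Q s j)) *v case_sum E z j)) (at s)"
    using der assms(3) by (simp add: Q_def[abs_def])
  then have "((\<lambda>s. F (Q s) t) has_vector_derivative (\<Sum>j\<in>I. d_state h j (P s) z t *v E j)) (at s)"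
    by (simp add: sum.reindex upd Q d_state_def)
  then show ?thesis by (simp add: F_def Q)
qed

lemma vfield_derivative:
  fixes f :: "real^'n \<Rightarrow> real \<Rightarrow> real^'n::finite"
  assumes "smooth (\<lambda>(X :: unit \<Rightarrow> real^'n) t. f (X ()) t)" "0 \<le> t"
  shows "((\<lambda>s. f (x + s *\<^sub>R e) t) has_vector_derivative
    jacobian (\<lambda>y. f y t) (at (x + s *\<^sub>R e)) *v e) (at s)"
  using smooth_has_vector_derivative_line[OF assms, of UNIV "\<lambda>_. x" "\<lambda>_. e" s]
  by (simp add: UNIV_unit)

text \<open>The superdiagonal block of row m lies outside the range of summation, which produces the
  case \<open>k < m\<close>.\<close>

lemma bapply_Adiag:
  "k \<le> m \<Longrightarrow> bapply m (Adiag \<N> i x z t) v k =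
    (if k = 0 then jacobian (\<lambda>y. vfield \<N> i y t) (at (x i)) *v v 0 else 0)
    + d_state (coupl \<N> i k) i x z t *v v 0 + (if k < m then v (Suc k) else 0)"
proof -
  have "Adiag \<N> i x z t k b =
      (if b = 0 then (if k = 0 then jacobian (\<lambda>y. vfield \<N> i y t) (at (x i)) else 0)
          + d_state (coupl \<N> i k) i x z t else 0)
      + (if b = Suc k then mat 1 else 0)" for b
    by (simp add: Adiag_def)
  then have "bapply m (Adiag \<N> i x z t) v k =
      (\<Sum>b\<le>m. (if b = 0 then ((if k = 0 then jacobian (\<lambda>y. vfield \<N> i y t) (at (x i)) else 0)
          + d_state (coupl \<N> i k) i x z t) *v v 0 else 0)
        + (if b = Suc k then v (Suc k) else 0))"
    unfolding bapply_def by (intro sum.cong refl) simp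
  then show ?thesis by (auto simp: sum.distrib matrix_vector_mult_add_rdistrib)
qed

lemma bapply_Aoff: "bapply m (Aoff \<N> i j x z t) v k = d_state (coupl \<N> i k) j x z t *v v 0"
  by (simp add: bapply_def Aoff_def if_distrib[where f="\<lambda>M. M *v _"] cong: if_cong)

lemma bapply_Bdel: "bapply m (Bdel \<N> i j x z t) v k = d_state (dcoupl \<N> i k) j x z t *v v 0"
  by (simp add: bapply_def Bdel_def if_distrib[where f="\<lambda>M. M *v _"] cong: if_cong)

section \<open>Halanay comparison\<close>

text \<open>A first-crossing argument on each interval between consecutive exceptional points; the margin
  \<open>\<epsilon>\<close> excludes a crossing at the left end point.\<close>

lemma comparison:
  fixes V :: "'i \<Rightarrow> real \<Rightarrow> real"
  assumes fin: "finite I"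
    and contV: "\<And>i. i \<in> I \<Longrightarrow> continuous_on {a..} (V i)"
    and contU: "continuous_on {a..} U"
    and S: "\<And>b. finite (S \<inter> {a..b})"
    and init: "\<And>i. i \<in> I \<Longrightarrow> V i a \<le> U a"
    and step: "\<And>\<epsilon> t i. 0 < \<epsilon> \<Longrightarrow> a < t \<Longrightarrow> t \<notin> S \<Longrightarrow> i \<in> I \<Longrightarrow>
        (\<forall>j\<in>I. \<forall>s\<in>{a..t}. V j s \<le> U s + \<epsilon>) \<Longrightarrow> V i t = U t + \<epsilon> \<Longrightarrow>
        \<exists>d>0. \<forall>s. t - d < s \<and> s < t \<longrightarrow> U s + \<epsilon> \<le> V i s"
    and i: "i \<in> I" and t: "a \<le> t"
  shows "V i t \<le> U t"
proof -
  have lim: "V j t \<le> U t + e"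
    if "a \<le> c" "c < t" "j \<in> I" "\<And>s. s \<in> {c..<t} \<Longrightarrow> V j s \<le> U s + e" for c t j e
  proof -
    have cl: "closure {c..<t} = {c..t}" using that by (simp add: closure_atLeastLessThan)
    have "continuous_on (closure {c..<t}) (\<lambda>s. V j s - U s)"
      unfolding cl using that
      by (intro continuous_intros continuous_on_subset[OF contV] continuous_on_subset[OF contU]) auto
    moreover have "t \<in> closure {c..<t}" using that by (simp add: cl)
    ultimately have "V j t - U t \<le> e"
      by (rule continuous_le_on_closure) (use that(4) in \<open>simp add: diff_le_eq add.commute\<close>)
    then show ?thesis by simp
  qed
  \<comment> \<open>No exceptional time lies strictly between c and b, so \<open>step\<close>
    applies at any first crossing there. The end b may itself be exceptional and is reached by
    continuity.\<close>
  have piece: "\<forall>j\<in>I. \<forall>s\<in>{a..b}. V j s \<le> U s"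
    if hist: "\<forall>j\<in>I. \<forall>s\<in>{a..c}. V j s \<le> U s" and c: "a \<le> c" "c < b" and Sb: "S \<inter> {c<..<b} = {}" for b c
  proof -
    have less: "V j s < U s + \<epsilon>" if \<epsilon>: "0 < \<epsilon>" and j: "j \<in> I" and s: "s \<in> {a..<b}" for \<epsilon> j s
    proof (rule ccontr)
      assume neg: "\<not> V j s < U s + \<epsilon>"
      \<comment> \<open>All times at which some \<open>V j\<close> has reached the raised bound; by
        compactness there is a first one.\<close>
      define B where "B = (\<Union>j\<in>I. {r\<in>{c..s}. U r + \<epsilon> \<le> V j r})"
      have cs: "c \<le> s" using hist j neg s \<epsilon> by (metis add_le_same_cancel1 atLeastAtMost_iff atLeastLessThan_iff le_cases not_le order_trans)
      have "compact B" unfolding B_def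
      proof (intro compact_UN fin)
        fix j assume j: "j \<in> I"
        have "closed {r\<in>{c..s}. U r + \<epsilon> \<le> V j r}"
          using c by (intro continuous_on_closed_Collect_le continuous_intros
              continuous_on_subset[OF contV[OF j]] continuous_on_subset[OF contU]) auto
        then have "compact ({c..s} \<inter> {r\<in>{c..s}. U r + \<epsilon> \<le> V j r})"
          by (intro compact_Int_closed) auto
        then show "compact {r\<in>{c..s}. U r + \<epsilon> \<le> V j r}" by (simp add: Int_def conj_ac cong: conj_cong)
      qed
      moreover have "s \<in> B" using neg j cs by (force simp: B_def not_less)
      ultimately obtain t where t: "t \<in> B" "\<And>r. r \<in> B \<Longrightarrow> t \<le> r"
        using compact_attains_inf[of B] by blast
      then obtain i where i: "i \<in> I" "U t + \<epsilon> \<le> V i t" "c \<le> t" "t \<le> s" by (auto simp: B_def)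
      have "t \<noteq> c" using hist i c \<epsilon> by force
      with i have ct: "c < t" by simp
      have before: "V k r < U r + \<epsilon>" if "k \<in> I" "r \<in> {c..<t}" for k r
        using t(2)[of r] that i(4) by (force simp: B_def)
      have at: "V k t \<le> U t + \<epsilon>" if "k \<in> I" for k
        using lim[OF c(1) ct that] before[OF that] by (simp add: less_imp_le)
      have "\<forall>k\<in>I. \<forall>r\<in>{a..t}. V k r \<le> U r + \<epsilon>"
      proof (intro ballI)
        fix k r assume "k \<in> I" "r \<in> {a..t}"
        then consider "r \<in> {a..c}" | "r \<in> {c..<t}" | "r = t" by force
        then show "V k r \<le> U r + \<epsilon>"
        proof cases
          case 1
          then have "V k r \<le> U r" using hist \<open>k \<in> I\<close> by blast
          then show ?thesis using \<epsilon> by simp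
        qed (use before at \<open>k \<in> I\<close> in \<open>auto simp: less_imp_le\<close>)
      qed
      moreover have "t \<notin> S" using Sb ct i(4) s by auto
      ultimately obtain d where d: "d > 0" "\<And>r. t - d < r \<Longrightarrow> r < t \<Longrightarrow> U r + \<epsilon> \<le> V i r"
        using step[of \<epsilon> t i] \<epsilon> c ct i at[OF i(1)] by force
      obtain r where "max c (t - d) < r" "r < t" using dense[of "max c (t - d)" t] ct d(1) by auto
      then show False using d(2)[of r] before[OF i(1), of r] by simp
    qed
    have le: "V j s \<le> U s" if "j \<in> I" "s \<in> {a..<b}" for j s
      by (rule field_le_epsilon) (use less[OF _ that] in \<open>simp add: less_imp_le\<close>)
    have "V j b \<le> U b + 0" if "j \<in> I" for j
      by (rule lim[OF c that]) (use le[OF that] c in auto)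
    with le show ?thesis by (metis add_0_right atLeastAtMost_iff atLeastLessThan_iff order_le_less)
  qed
  \<comment> \<open>Split at the last exceptional point c before t: fewer exceptional points precede
    c, and none lies between c and t.\<close>
  have "\<forall>j\<in>I. \<forall>s\<in>{a..t}. V j s \<le> U s" using t
  proof (induction "card (S \<inter> {a<..<t})" arbitrary: t rule: less_induct)
    case less
    let ?F = "S \<inter> {a<..<t}"
    have finF: "finite ?F" by (rule finite_subset[OF _ S[of t]]) auto
    show ?case
    proof (cases "a = t")
      case True
      then show ?thesis using init by auto
    next
      case False
      with less have at: "a < t" by simp
      show ?thesis
      proof (cases "?F = {}")
        case True
        then show ?thesis using piece[of a t] init at by auto
      next
        case False
        define c where "c = Max ?F"
        have c: "c \<in> ?F" "\<And>s. s \<in> ?F \<Longrightarrow> s \<le> c"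
          using False finF Max_in[OF finF] by (auto simp: c_def simp del: Int_iff)
        have "card (S \<inter> {a<..<c}) < card ?F" using c finF by (intro psubset_card_mono) auto
        then have "\<forall>j\<in>I. \<forall>s\<in>{a..c}. V j s \<le> U s" using less(1)[of c] c by auto
        then show ?thesis using c by (intro piece[of c t]) force+
      qed
    qed
  qed
  then show ?thesis using i t by auto
qed

text \<open>The left-hand side is strictly increasing in the rate, negative at 0 and nonnegative at
  \<sigma>hi.\<close>

lemma Halanay_rate:
  fixes \<sigma>lo \<sigma>hi \<tau> :: real
  assumes "0 \<le> \<sigma>lo" "\<sigma>lo < \<sigma>hi" "0 \<le> \<tau>"
  shows "\<exists>!rate. rate > 0 \<and> rate - \<sigma>hi + \<sigma>lo * exp (rate * \<tau>) = 0"
proof -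
  define g where "g r = r - \<sigma>hi + \<sigma>lo * exp (r * \<tau>)" for r
  have mono: "g r < g s" if "r < s" for r s
    using that assms by (auto simp: g_def intro!: add_less_le_mono mult_left_mono mult_right_mono)
  have "\<exists>r\<ge>0. r \<le> \<sigma>hi \<and> g r = 0"
    using assms by (intro IVT') (auto simp: g_def intro!: continuous_intros)
  then obtain r where r: "0 \<le> r" "g r = 0" by blast
  moreover have "g 0 < 0" using assms by (simp add: g_def)
  ultimately have "0 < r" by (metis less_irrefl order_le_less)
  then show ?thesis using r mono by (metis g_def less_irrefl linorder_less_linear)
qed

section \<open>Polynomial disturbances\<close>

text \<open>The derivative of order j of \<open>dbar m c\<close>, with falling factorials as
  quotients. It mediates between the iterated derivatives in the definition of scalability and the
  explicit sum in the bound.\<close>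

definition dpoly :: "nat \<Rightarrow> nat \<Rightarrow> (nat \<Rightarrow> real^'n) \<Rightarrow> real \<Rightarrow> real^'n" where
  "dpoly m j c t = (\<Sum>l\<in>{j..<m}. (fact l / fact (l - j) * t ^ (l - j)) *\<^sub>R c l)"

lemma dpoly_0: "dpoly m 0 c = dbar m c"
  by (auto simp: dpoly_def dbar_def lessThan_atLeast0)

lemma dpoly_self: "dpoly m m c = (\<lambda>_. 0)"
  by (simp add: dpoly_def fun_eq_iff)

lemma dpoly_deriv: "(dpoly m j c has_vector_derivative dpoly m (Suc j) c t) (at t within A)"
proof -
  \<comment> \<open>For l = j the monomial is constant. The general formula would be wrong there:
    truncated subtraction would leave a nonzero factor.\<close>
  have "((\<lambda>t. (fact l / fact (l - j) * t ^ (l - j)) *\<^sub>R c l) has_vector_derivative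
      (if l = j then 0 else (fact l / fact (l - Suc j) * t ^ (l - Suc j)) *\<^sub>R c l)) (at t within A)"
    if "j \<le> l" for l
  proof (cases "l = j")
    case False
    with that obtain q where q: "l = Suc (j + q)" by (metis le_neq_implies_less less_iff_Suc_add)
    have "((\<lambda>t. fact l / fact (l - j) * t ^ (l - j)) has_real_derivative
        (fact l / fact (Suc q) * (real (Suc q) * t ^ q))) (at t within A)"
      using DERIV_cmult[OF DERIV_pow[of "Suc q" t A], of "fact l / fact (Suc q)"]
      unfolding q by (simp del: of_nat_Suc fact_Suc)
    moreover have "fact l / fact (Suc q) * (real (Suc q) * t ^ q) = fact l / fact (l - Suc j) * t ^ (l - Suc j)"
      unfolding q by (simp del: of_nat_Suc)
    ultimately have "((\<lambda>t. fact l / fact (l - j) * t ^ (l - j)) has_vector_derivative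
        (fact l / fact (l - Suc j) * t ^ (l - Suc j))) (at t within A)"
      by (simp only: has_real_derivative_iff_has_vector_derivative)
    then show ?thesis
      using False bounded_linear.has_vector_derivative[OF bounded_linear_scaleR_left] by simp
  qed auto
  then have "(dpoly m j c has_vector_derivative
      (\<Sum>l\<in>{j..<m}. if l = j then 0 else (fact l / fact (l - Suc j) * t ^ (l - Suc j)) *\<^sub>R c l)) (at t within A)"
    unfolding dpoly_def by (intro has_vector_derivative_sum) auto
  also have "(\<Sum>l\<in>{j..<m}. if l = j then 0 else (fact l / fact (l - Suc j) * t ^ (l - Suc j)) *\<^sub>R c l)
      = dpoly m (Suc j) c t"
    unfolding dpoly_def by (intro sum.mono_neutral_cong_right) auto
  finally show ?thesis .
qed

lemma dbar_deriv_eq: "dbar_deriv m j c = dpoly m j c"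
proof (induction j)
  case (Suc j)
  then show ?case
    by (simp add: dbar_deriv_def vector_derivative_at[OF dpoly_deriv])
qed (simp add: dbar_deriv_def dpoly_0)

text \<open>Substitute l = m - 1 - b: then l - (k - 1) = m - k - b, and \<open>b \<le> m - k\<close>
  says that \<open>l \<ge> k - 1\<close>.\<close>

lemma dpoly_explicit:
  assumes "1 \<le> k" "k \<le> m"
  shows "(\<Sum>b=0..m-k. (fact (m - 1 - b) / fact (m - k - b) * s ^ (m - k - b)) *\<^sub>R c (m - 1 - b))
    = dpoly m (k - 1) c s"
  unfolding dpoly_def
  by (rule sum.reindex_bij_witness[of _ "\<lambda>l. m - 1 - l" "\<lambda>b. m - 1 - b"]) (use assms in \<open>auto simp: add.commute\<close>)

section \<open>The perturbed network\<close>

text \<open>Continuity on a compact interval makes the supremum genuine; an unbounded one would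
  carry no information.\<close>

lemma le_MAX_SUP:
  fixes f :: "'i \<Rightarrow> real \<Rightarrow> real"
  assumes "finite I" "i \<in> I" "s \<in> {a..b}" "continuous_on {a..b} (f i)"
  shows "f i s \<le> (MAX i\<in>I. SUP s\<in>{a..b}. f i s)"
proof -
  have "bdd_above (f i ` {a..b})"
    using assms by (intro bounded_imp_bdd_above compact_imp_bounded compact_continuous_image) auto
  then have "f i s \<le> (SUP s\<in>{a..b}. f i s)" using assms by (intro cSUP_upper) auto
  also have "\<dots> \<le> (MAX i\<in>I. SUP s\<in>{a..b}. f i s)" using assms by simp
  finally show ?thesis .
qed

locale perturbed_network =
  fixes \<N> :: "'n::finite network"
    and p :: ereal
    and m nbound N :: nat
    and \<tau>max \<sigma>lo \<sigma>hi rate :: real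
    and \<alpha> :: "nat \<Rightarrow> real"
    and xs x w :: "nat \<Rightarrow> real \<Rightarrow> real^'n"
    and c :: "nat \<Rightarrow> nat \<Rightarrow> real^'n"
    and r :: "nat \<Rightarrow> nat \<Rightarrow> real \<Rightarrow> real^'n"
  assumes p: "1 \<le> p" and m: "1 \<le> m" and N: "1 \<le> N"
    and network: "multiplex_network m nbound \<tau>max N \<N>"
    and desired: "desired_solution \<tau>max N \<N> xs"
    and sigma: "0 \<le> \<sigma>lo" "\<sigma>lo < \<sigma>hi"
    and C1: "\<And>t i k. t \<ge> start \<N> \<Longrightarrow> i \<in> {1..N} \<Longrightarrow> k \<le> m \<Longrightarrow>
        coupl_at \<N> i k xs t = 0 \<and> dcoupl_at \<N> i k xs t = 0"
    and C2: "\<And>t i x z. t \<ge> start \<N> \<Longrightarrow> i \<in> {1..N} \<Longrightarrow>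
        bmeasure p m (bconj m (Tbar \<alpha>) (Adiag \<N> i x z t))
          + (\<Sum>j\<in>{1..N} - {i}. bnorm p m (bconj m (Tbar \<alpha>) (Aoff \<N> i j x z t))) \<le> - \<sigma>hi"
    and C3: "\<And>t i x z. t \<ge> start \<N> \<Longrightarrow> i \<in> {1..N} \<Longrightarrow>
        (\<Sum>j\<in>{1..N}. bnorm p m (bconj m (Tbar \<alpha>) (Bdel \<N> i j x z t))) \<le> \<sigma>lo"
    and rate: "rate > 0" "rate - \<sigma>hi + \<sigma>lo * exp (rate * \<tau>max) = 0"
    and disturbance: "disturbance N \<N> w"
    and loop: "closed_loop m \<tau>max N \<N> w c x r"
begin

abbreviation "T \<equiv> Tbar \<alpha> :: 'n bmat"

text \<open>The deviation from the desired solution; the layers \<open>r i k\<close> are compared with the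
  derivatives of the polynomial disturbance that they are meant to cancel.\<close>

definition dev :: "nat \<Rightarrow> real \<Rightarrow> 'n bvec" where
  "dev i t k = (if k = 0 then x i t - xs i t else r i k t + dpoly m (k - 1) (c i) t)"

definition dev_rhs :: "nat \<Rightarrow> real \<Rightarrow> 'n bvec" where
  "dev_rhs i t k = coupl_at \<N> i k x t + dcoupl_at \<N> i k x t
     + (if k = 0 then vfield \<N> i (x i t) t - vfield \<N> i (xs i t) t + w i t else 0)
     + (if k < m then dev i t (Suc k) else 0)"

definition V :: "nat \<Rightarrow> real \<Rightarrow> real" where
  "V i t = bvnorm p m (bapply m T (dev i t))"

definition W :: real where
  "W = (MAX i\<in>{1..N}. Linf p (start \<N>) (w i))"

definition M1 :: real where
  "M1 = (MAX i\<in>{1..N}. SUP s\<in>{start \<N> - \<tau>max..start \<N>}. vnorm p (x i s - xs i s))"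

definition M2 :: real where
  "M2 = (MAX i\<in>{1..N}. SUP s\<in>{start \<N> - \<tau>max..start \<N>}.
     \<Sum>k=1..m. vnorm p (r i k s + dpoly m (k - 1) (c i) s))"

definition U :: "real \<Rightarrow> real" where
  "U t = bnorm p m T * W / (\<sigma>hi - \<sigma>lo)
    + bnorm p m T * (M1 + M2) * exp (- rate * (t - start \<N>))"

lemma start_nonneg: "0 \<le> start \<N>"
  and delay: "t \<ge> start \<N> \<Longrightarrow> 0 \<le> delay \<N> t \<and> delay \<N> t \<le> \<tau>max"
  and smooth_vfield: "i \<in> {1..N} \<Longrightarrow> smooth (\<lambda>(X :: unit \<Rightarrow> real^'n) t. vfield \<N> i (X ()) t)"
  and nbrs: "i \<in> {1..N} \<Longrightarrow> nbrs \<N> i \<subseteq> {1..N}"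
  and smooth_coupl: "i \<in> {1..N} \<Longrightarrow> k \<le> m \<Longrightarrow>
      smooth_coupling (insert i (nbrs \<N> i)) {1..leaders \<N>} (coupl \<N> i k)"
  and smooth_dcoupl: "i \<in> {1..N} \<Longrightarrow> k \<le> m \<Longrightarrow>
      smooth_coupling (insert i (nbrs \<N> i)) {1..leaders \<N>} (dcoupl \<N> i k)"
  using network unfolding multiplex_network_def by auto

lemma coupl_local:
  assumes "i \<in> {1..N}" "k \<le> m" "0 \<le> t" "\<And>j. j \<in> insert i (nbrs \<N> i) \<Longrightarrow> y j = y' j"
  shows "coupl \<N> i k y z t = coupl \<N> i k y' z t"
  using smooth_coupl[OF assms(1,2)] assms(3,4) unfolding smooth_coupling_def by blast

lemma dcoupl_local:
  assumes "i \<in> {1..N}" "k \<le> m" "0 \<le> t" "\<And>j. j \<in> insert i (nbrs \<N> i) \<Longrightarrow> y j = y' j"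
  shows "dcoupl \<N> i k y z t = dcoupl \<N> i k y' z t"
  using smooth_dcoupl[OF assms(1,2)] assms(3,4) unfolding smooth_coupling_def by blast

lemma \<tau>max_nonneg: "0 \<le> \<tau>max"
  using delay[of "start \<N>"] by linarith

lemma continuous_x: "i \<in> {1..N} \<Longrightarrow> continuous_on {start \<N> - \<tau>max..} (x i)"
  and continuous_r: "i \<in> {1..N} \<Longrightarrow> 1 \<le> k \<Longrightarrow> k \<le> m \<Longrightarrow> continuous_on {start \<N> - \<tau>max..} (r i k)"
  using loop unfolding closed_loop_def by auto

lemma continuous_xs:
  assumes i: "i \<in> {1..N}"
  shows "continuous_on {start \<N> - \<tau>max..} (xs i)"
proof -
  have "continuous_on {start \<N> - \<tau>max..start \<N>} (\<lambda>_. xs i (start \<N>))" by simp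
  then have "continuous_on {start \<N> - \<tau>max..start \<N>} (xs i)"
    by (rule continuous_on_eq) (metis desired desired_solution_def i)
  moreover have "continuous_on {start \<N>..} (xs i)"
    using desired i by (intro continuous_on_vector_derivative) (auto simp: desired_solution_def)
  ultimately have "continuous_on ({start \<N> - \<tau>max..start \<N>} \<union> {start \<N>..}) (xs i)"
    by (intro continuous_on_closed_Un) auto
  moreover have "{start \<N> - \<tau>max..start \<N>} \<union> {start \<N>..} = {start \<N> - \<tau>max..}"
    using \<tau>max_nonneg by auto
  ultimately show ?thesis by simp
qed

lemma continuous_dpoly: "continuous_on A (dpoly m k (c i))"
  by (rule continuous_on_vector_derivative[OF dpoly_deriv])

lemma continuous_dev:
  assumes i: "i \<in> {1..N}" and k: "k \<le> m"
  shows "continuous_on {start \<N> - \<tau>max..} (\<lambda>t. dev i t k)"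
  unfolding dev_def using i k
  by (cases "k = 0") (auto intro!: continuous_intros continuous_x continuous_xs continuous_r continuous_dpoly)

lemma continuous_V:
  assumes i: "i \<in> {1..N}"
  shows "continuous_on {start \<N> - \<tau>max..} (V i)"
  unfolding V_def[abs_def] bapply_def
  by (intro continuous_on_bvnorm p continuous_on_sum
      bounded_linear.continuous_on[OF matrix_vector_mul_bounded_linear] continuous_dev i) auto

text \<open>The boundedness contained in \<open>disturbance\<close> makes \<open>Linf\<close> a
  genuine supremum.\<close>

lemma vnorm_w_le:
  assumes "i \<in> {1..N}" "t \<ge> start \<N>"
  shows "vnorm p (w i t) \<le> W"
proof -
  have "bounded (w i ` {start \<N>..})" using disturbance assms(1) unfolding disturbance_def by blast
  then obtain B where "\<And>t. t \<ge> start \<N> \<Longrightarrow> norm (w i t) \<le> B" unfolding bounded_iff by auto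
  then have "vnorm p (w i t) \<le> real CARD('n) * B" if "t \<ge> start \<N>" for t
    using order_trans[OF vnorm_le[OF p, of "w i t"] mult_left_mono] that by auto
  then have "bdd_above ((\<lambda>t. vnorm p (w i t)) ` {start \<N>..})" by (intro bdd_aboveI) auto
  then have "vnorm p (w i t) \<le> Linf p (start \<N>) (w i)"
    unfolding Linf_def using assms by (intro cSUP_upper) auto
  also have "\<dots> \<le> W" unfolding W_def using assms by simp
  finally show ?thesis .
qed

lemma W_nonneg: "0 \<le> W"
  using vnorm_w_le[of 1 "start \<N>"] N vnorm_nonneg[of p "w 1 (start \<N>)"] by auto

text \<open>The norm of a stacked vector is at most the sum of the norms of its blocks, which is
  where the sum over the layers in the initial term comes from.\<close>

lemma dev_initial:
  assumes i: "i \<in> {1..N}" and s: "s \<in> {start \<N> - \<tau>max..start \<N>}"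
  shows "bvnorm p m (dev i s) \<le> M1 + M2"
proof -
  have "vnorm p (x i s - xs i s) \<le> M1" unfolding M1_def using i s
    by (intro le_MAX_SUP[where f="\<lambda>i s. vnorm p (x i s - xs i s)"] continuous_on_vnorm p continuous_intros
        continuous_on_subset[OF continuous_x[OF i]] continuous_on_subset[OF continuous_xs[OF i]]) auto
  moreover have "(\<Sum>k=1..m. vnorm p (r i k s + dpoly m (k - 1) (c i) s)) \<le> M2" unfolding M2_def using i s
    by (intro le_MAX_SUP[where f="\<lambda>i s. \<Sum>k=1..m. vnorm p (r i k s + dpoly m (k - 1) (c i) s)"]
        continuous_on_sum continuous_on_vnorm p continuous_intros
        continuous_on_subset[OF continuous_r[OF i]] continuous_dpoly) auto
  moreover have "(\<Sum>k\<le>m. vnorm p (dev i s k))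
      = vnorm p (x i s - xs i s) + (\<Sum>k=1..m. vnorm p (r i k s + dpoly m (k - 1) (c i) s))"
    by (simp add: dev_def atMost_atLeast0 sum.atLeast_Suc_atMost)
  ultimately show ?thesis using bvnorm_le_sum[OF p, of m "dev i s"] by linarith
qed

lemma M_nonneg: "0 \<le> M1 + M2"
  using dev_initial[of 1 "start \<N>"] N \<tau>max_nonneg bvnorm_nonneg[of p m "dev 1 (start \<N>)"] by auto

lemma V_initial:
  assumes "i \<in> {1..N}" "s \<in> {start \<N> - \<tau>max..start \<N>}"
  shows "V i s \<le> bnorm p m T * (M1 + M2)"
  unfolding V_def
  by (rule order_trans[OF bvnorm_bapply_le[OF p]])
     (intro mult_left_mono bnorm_nonneg p dev_initial assms)

lemma dev_derivative:
  obtains S where "\<And>b. finite (S \<inter> {start \<N>..b})"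
    and "\<And>i t k. i \<in> {1..N} \<Longrightarrow> start \<N> < t \<Longrightarrow> t \<notin> S \<Longrightarrow> k \<le> m \<Longrightarrow>
      ((\<lambda>t. dev i t k) has_vector_derivative dev_rhs i t k) (at t)"
proof -
  obtain S where S: "\<And>b. finite (S \<inter> {start \<N>..b})"
    "\<And>i t. i \<in> {1..N} \<Longrightarrow> t \<in> {start \<N>..} - S \<Longrightarrow>
           (x i has_vector_derivative
              vfield \<N> i (x i t) t + input \<N> x r i t + (w i t + dbar m (c i) t))
             (at t within {start \<N>..}) \<and>
           (\<forall>k\<in>{1..<m}. (r i k has_vector_derivative
              coupl_at \<N> i k x t + dcoupl_at \<N> i k x t + r i (k + 1) t)
             (at t within {start \<N>..})) \<and>
           (r i m has_vector_derivative coupl_at \<N> i m x t + dcoupl_at \<N> i m x t)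
             (at t within {start \<N>..})"
    using loop unfolding closed_loop_def by blast
  show ?thesis
  proof (rule that[OF S(1)])
    fix i t k assume i: "i \<in> {1..N}" and t: "start \<N> < t" "t \<notin> S" and k: "k \<le> m"
    have at: "at t within {start \<N>..} = at t" using t by (intro at_within_interior) simp
    note S2 = S(2)[OF i, of t, unfolded at]
    have xs: "(xs i has_vector_derivative vfield \<N> i (xs i t) t) (at t)"
      using desired i t unfolding desired_solution_def by (metis at less_imp_le)
    \<comment> \<open>Block k carries the derivative of order k - 1, so its derivative supplies
      order k, which completes \<open>r i (k + 1)\<close> to block k + 1. For k = 0,
      \<open>dbar\<close> itself completes \<open>r i 1\<close>; for k = m, order m
      vanishes.\<close>
    consider "k = 0" | "1 \<le> k" "k < m" | "1 \<le> k" "k = m" using k by linarith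
    then show "((\<lambda>t. dev i t k) has_vector_derivative dev_rhs i t k) (at t)"
    proof cases
      case 1
      have "((\<lambda>t. x i t - xs i t) has_vector_derivative
          vfield \<N> i (x i t) t + input \<N> x r i t + (w i t + dbar m (c i) t) - vfield \<N> i (xs i t) t) (at t)"
        using S2 t by (intro has_vector_derivative_diff xs) auto
      then show ?thesis using m 1 by (simp add: dev_rhs_def dev_def input_def dpoly_0 algebra_simps)
    next
      case 2
      have "((\<lambda>t. r i k t + dpoly m (k - 1) (c i) t) has_vector_derivative
          coupl_at \<N> i k x t + dcoupl_at \<N> i k x t + r i (k + 1) t + dpoly m (Suc (k - 1)) (c i) t) (at t)"
        using S2 t 2 by (intro has_vector_derivative_add dpoly_deriv) auto
      then show ?thesis using 2 by (simp add: dev_rhs_def dev_def algebra_simps)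
    next
      case 3
      have "((\<lambda>t. r i k t + dpoly m (k - 1) (c i) t) has_vector_derivative
          coupl_at \<N> i k x t + dcoupl_at \<N> i k x t + dpoly m (Suc (k - 1)) (c i) t) (at t)"
        using S2 t 3 by (intro has_vector_derivative_add dpoly_deriv) auto
      then show ?thesis using 3 by (simp add: dev_rhs_def dev_def dpoly_self)
    qed
  qed
qed

text \<open>The mean value theorem is applied to the scalar function \<open>\<eta> \<mapsto> \<phi> (T (g \<eta>))\<close>, so that a single
  intermediate point serves all blocks and all neighbours.\<close>

lemma mean_value:
  fixes \<phi> :: "'n bvec"
  assumes i: "i \<in> {1..N}" and t: "start \<N> \<le> t"
  defines "t' \<equiv> t - delay \<N> t"
  obtains X X' z z' where
    "bdot m \<phi> (bapply m T (dev_rhs i t))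
     = bdot m \<phi> (bapply m T (bapply m (Adiag \<N> i X z t) (dev i t)))
       + (\<Sum>j\<in>{1..N} - {i}. bdot m \<phi> (bapply m T (bapply m (Aoff \<N> i j X z t) (dev j t))))
       + (\<Sum>j\<in>{1..N}. bdot m \<phi> (bapply m T (bapply m (Bdel \<N> i j X' z' t) (dev j t'))))
       + bdot m \<phi> (bapply m T (\<lambda>k. if k = 0 then w i t else 0))"
proof -
  \<comment> \<open>One parameter runs along both segments from desired to actual states, at time t
    and at the delayed time, so that one scalar function contains every coupling. The leader values
    stay fixed.\<close>
  define X where "X \<eta> = (\<lambda>j. if j \<in> {1..N} then xs j t + \<eta> *\<^sub>R dev j t 0 else xs j t)" for \<eta>
  define X' where "X' \<eta> = (\<lambda>j. if j \<in> {1..N} then xs j t' + \<eta> *\<^sub>R dev j t' 0 else xs j t')" for \<eta>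
  define z where "z = (\<lambda>l. leader_ref \<N> l t)"
  define z' where "z' = (\<lambda>l. leader_ref \<N> l t')"
  define g where "g \<eta> k = coupl \<N> i k (X \<eta>) z t + dcoupl \<N> i k (X' \<eta>) z' t
      + (if k = 0 then vfield \<N> i (xs i t + \<eta> *\<^sub>R dev i t 0) t else 0)" for \<eta> k
  define g' where "g' \<eta> k = (\<Sum>j\<in>{1..N}. d_state (coupl \<N> i k) j (X \<eta>) z t *v dev j t 0)
      + (\<Sum>j\<in>{1..N}. d_state (dcoupl \<N> i k) j (X' \<eta>) z' t *v dev j t' 0)
      + (if k = 0 then jacobian (\<lambda>y. vfield \<N> i y t) (at (xs i t + \<eta> *\<^sub>R dev i t 0)) *v dev i t 0 else 0)"
    for \<eta> k
  have t0: "0 \<le> t" using t start_nonneg by linarith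
  have der: "((\<lambda>\<eta>. g \<eta> k) has_vector_derivative g' \<eta> k) (at \<eta>)" if "k \<le> m" for k \<eta>
  proof -
    have "((\<lambda>\<eta>. coupl \<N> i k (X \<eta>) z t) has_vector_derivative
        (\<Sum>j\<in>{1..N}. d_state (coupl \<N> i k) j (X \<eta>) z t *v dev j t 0)) (at \<eta>)"
      unfolding X_def by (rule coupling_derivative[OF smooth_coupl[OF i that] t0]) simp
    moreover have "((\<lambda>\<eta>. dcoupl \<N> i k (X' \<eta>) z' t) has_vector_derivative
        (\<Sum>j\<in>{1..N}. d_state (dcoupl \<N> i k) j (X' \<eta>) z' t *v dev j t' 0)) (at \<eta>)"
      unfolding X'_def by (rule coupling_derivative[OF smooth_dcoupl[OF i that] t0]) simp
    moreover have "((\<lambda>\<eta>. if k = 0 then vfield \<N> i (xs i t + \<eta> *\<^sub>R dev i t 0) t else 0) has_vector_derivative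
        (if k = 0 then jacobian (\<lambda>y. vfield \<N> i y t) (at (xs i t + \<eta> *\<^sub>R dev i t 0)) *v dev i t 0 else 0)) (at \<eta>)"
      using vfield_derivative[OF smooth_vfield[OF i] t0] by simp
    ultimately show ?thesis unfolding g_def g'_def by (intro has_vector_derivative_add)
  qed
  have "\<exists>\<eta>>0. \<eta> < 1 \<and> bdot m \<phi> (bapply m T (g 1)) - bdot m \<phi> (bapply m T (g 0))
      = (1 - 0) * bdot m \<phi> (bapply m T (g' \<eta>))"
    by (rule MVT2) (auto intro!: has_real_derivative_bdot_bapply der)
  then obtain \<eta> where \<eta>: "bdot m \<phi> (bapply m T (g 1)) - bdot m \<phi> (bapply m T (g 0)) = bdot m \<phi> (bapply m T (g' \<eta>))"
    by auto
  \<comment> \<open>Outside the network the segments stay at xs; by locality the couplings do not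
    see those indices.\<close>
  have g1: "g 1 k = coupl_at \<N> i k x t + dcoupl_at \<N> i k x t + (if k = 0 then vfield \<N> i (x i t) t else 0)"
    if "k \<le> m" for k
  proof -
    have "coupl \<N> i k (X 1) z t = coupl_at \<N> i k x t"
      unfolding coupl_at_def z_def
    proof (rule coupl_local[OF i that t0])
      fix j assume "j \<in> insert i (nbrs \<N> i)"
      then have "j \<in> {1..N}" using nbrs[OF i] i by blast
      then show "X 1 j = x j t" by (simp add: X_def dev_def)
    qed
    moreover have "dcoupl \<N> i k (X' 1) z' t = dcoupl_at \<N> i k x t"
      unfolding dcoupl_at_def z'_def t'_def[symmetric]
    proof (rule dcoupl_local[OF i that t0])
      fix j assume "j \<in> insert i (nbrs \<N> i)"
      then have "j \<in> {1..N}" using nbrs[OF i] i by blast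
      then show "X' 1 j = x j t'" by (simp add: X'_def dev_def)
    qed
    ultimately show ?thesis by (simp add: g_def dev_def)
  qed
  \<comment> \<open>(C1) enters here: the couplings vanish at the desired end of the segments, so g
    1 - g 0 is the whole nonlinear part of the error dynamics.\<close>
  have g0: "g 0 k = (if k = 0 then vfield \<N> i (xs i t) t else 0)" if "k \<le> m" for k
  proof -
    have "X 0 = (\<lambda>j. xs j t)" "X' 0 = (\<lambda>j. xs j t')" by (auto simp: X_def X'_def)
    then show ?thesis using C1[OF t i that]
      by (simp add: g_def coupl_at_def dcoupl_at_def z_def z'_def t'_def)
  qed
  \<comment> \<open>The chain of layers is linear and was kept out of g; added now, it supplies the
    superdiagonal identity blocks of \<open>Adiag\<close>.\<close>
  have split: "g' \<eta> k + (if k < m then dev i t (Suc k) else 0)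
      = bapply m (Adiag \<N> i (X \<eta>) z t) (dev i t) k
        + (\<Sum>j\<in>{1..N} - {i}. bapply m (Aoff \<N> i j (X \<eta>) z t) (dev j t) k)
        + (\<Sum>j\<in>{1..N}. bapply m (Bdel \<N> i j (X' \<eta>) z' t) (dev j t') k)" if "k \<le> m" for k
  proof -
    have "X \<eta> i = xs i t + \<eta> *\<^sub>R dev i t 0" using i by (simp add: X_def)
    moreover have "(\<Sum>j\<in>{1..N}. d_state (coupl \<N> i k) j (X \<eta>) z t *v dev j t 0)
        = d_state (coupl \<N> i k) i (X \<eta>) z t *v dev i t 0
          + (\<Sum>j\<in>{1..N} - {i}. d_state (coupl \<N> i k) j (X \<eta>) z t *v dev j t 0)"
      using i by (intro sum.remove) auto
    ultimately show ?thesis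
      by (simp only: g'_def bapply_Adiag[OF that] bapply_Aoff bapply_Bdel) simp
  qed
  show ?thesis
  proof (rule that[of "X \<eta>" z "X' \<eta>" z'])
    have "bdot m \<phi> (bapply m T (dev_rhs i t))
      = bdot m \<phi> (bapply m T (\<lambda>k. ((g 1 k - g 0 k) + (if k < m then dev i t (Suc k) else 0))
          + (if k = 0 then w i t else 0)))"
      by (intro arg_cong[where f="bdot m \<phi>"] bapply_cong) (auto simp: g1 g0 dev_rhs_def)
    also have "\<dots> = bdot m \<phi> (bapply m T (\<lambda>k. g' \<eta> k + (if k < m then dev i t (Suc k) else 0)))
        + bdot m \<phi> (bapply m T (\<lambda>k. if k = 0 then w i t else 0))"
      unfolding bdot_bapply_add bdot_bapply_diff \<eta> ..
    also have "bapply m T (\<lambda>k. g' \<eta> k + (if k < m then dev i t (Suc k) else 0))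
        = bapply m T (\<lambda>k. bapply m (Adiag \<N> i (X \<eta>) z t) (dev i t) k
          + (\<Sum>j\<in>{1..N} - {i}. bapply m (Aoff \<N> i j (X \<eta>) z t) (dev j t) k)
          + (\<Sum>j\<in>{1..N}. bapply m (Bdel \<N> i j (X' \<eta>) z' t) (dev j t') k))"
      by (intro bapply_cong split)
    finally show "bdot m \<phi> (bapply m T (dev_rhs i t))
     = bdot m \<phi> (bapply m T (bapply m (Adiag \<N> i (X \<eta>) z t) (dev i t)))
       + (\<Sum>j\<in>{1..N} - {i}. bdot m \<phi> (bapply m T (bapply m (Aoff \<N> i j (X \<eta>) z t) (dev j t))))
       + (\<Sum>j\<in>{1..N}. bdot m \<phi> (bapply m T (bapply m (Bdel \<N> i j (X' \<eta>) z' t) (dev j t'))))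
       + bdot m \<phi> (bapply m T (\<lambda>k. if k = 0 then w i t else 0))"
      by (simp only: bdot_bapply_add bdot_bapply_sum)
  qed
qed

lemma V_le_U:
  assumes "i \<in> {1..N}" "start \<N> \<le> t"
  shows "V i t \<le> U t"
proof -
  obtain S where S: "\<And>b. finite (S \<inter> {start \<N>..b})"
    "\<And>i t k. i \<in> {1..N} \<Longrightarrow> start \<N> < t \<Longrightarrow> t \<notin> S \<Longrightarrow> k \<le> m \<Longrightarrow>
      ((\<lambda>t. dev i t k) has_vector_derivative dev_rhs i t k) (at t)"
    using dev_derivative by metis
  define K where "K = bnorm p m T * W / (\<sigma>hi - \<sigma>lo)"
  define M where "M = bnorm p m T * (M1 + M2)"
  have M: "0 \<le> M" unfolding M_def by (intro mult_nonneg_nonneg bnorm_nonneg p M_nonneg)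
  have K: "0 \<le> K" unfolding K_def using sigma W_nonneg bnorm_nonneg[OF p, of m T] by simp
  have U: "U s = K + M * exp (- rate * (s - start \<N>))" for s by (simp add: U_def K_def M_def)
  show ?thesis
  proof (rule comparison[of "{1..N}" "start \<N>" V U S])
    show "continuous_on {start \<N>..} (V i)" if "i \<in> {1..N}" for i
      by (rule continuous_on_subset[OF continuous_V[OF that]]) (use \<tau>max_nonneg in auto)
    show "continuous_on {start \<N>..} U" unfolding U_def by (intro continuous_intros)
    show "V i (start \<N>) \<le> U (start \<N>)" if "i \<in> {1..N}" for i
      using V_initial[OF that, of "start \<N>"] \<tau>max_nonneg K by (simp add: U M_def)
  next
    fix \<epsilon> t i
    assume \<epsilon>: "0 < \<epsilon>" and t: "start \<N> < t" "t \<notin> S" and i: "i \<in> {1..N}"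
      and hist: "\<forall>j\<in>{1..N}. \<forall>s\<in>{start \<N>..t}. V j s \<le> U s + \<epsilon>" and Vt: "V i t = U t + \<epsilon>"
    define E where "E = exp (- rate * (t - start \<N>))"
    define t' where "t' = t - delay \<N> t"
    define R where "R = K + M * E + \<epsilon>"
    \<comment> \<open>A bound for every \<open>V j\<close> at the delayed time: going back by at
      most \<tau>max enlarges the exponential by at most
      \<open>exp (rate * \<tau>max)\<close>.\<close>
    define R' where "R' = K + M * (exp (rate * \<tau>max) * E) + \<epsilon>"
    have d: "0 \<le> delay \<N> t" "delay \<N> t \<le> \<tau>max" using delay[of t] t by auto
    have VR: "V j t \<le> R" if "j \<in> {1..N}" for j
      using hist that t by (auto simp: U R_def E_def)
    have R0: "0 \<le> R" using K M \<epsilon> by (simp add: R_def E_def)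
    have R'0: "0 \<le> R'" using K M \<epsilon> by (simp add: R'_def E_def)
    have VR': "V j t' \<le> R'" if j: "j \<in> {1..N}" for j
    proof -
      \<comment> \<open>A delayed time before the start lies in the initial interval, where
        \<open>V j \<le> M\<close> and the exponential is at least 1.\<close>
      have "V j t' \<le> K + M * exp (- rate * (t' - start \<N>)) + \<epsilon>"
      proof (cases "start \<N> \<le> t'")
        case True
        then show ?thesis using hist j d by (auto simp: t'_def U)
      next
        case False
        then have "t' \<in> {start \<N> - \<tau>max..start \<N>}" using d t by (auto simp: t'_def)
        then have "V j t' \<le> M" using V_initial[OF j] by (simp add: M_def)
        moreover have "M * 1 \<le> M * exp (- rate * (t' - start \<N>))"
          using False rate(1) M by (intro mult_left_mono) (auto intro!: mult_nonneg_nonpos)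
        ultimately show ?thesis using K \<epsilon> by linarith
      qed
      also have "\<dots> \<le> R'"
      proof -
        have "- rate * (t' - start \<N>) \<le> rate * \<tau>max + - rate * (t - start \<N>)"
          using mult_left_mono[OF d(2), of rate] rate(1) by (simp add: t'_def algebra_simps)
        then have "exp (- rate * (t' - start \<N>)) \<le> exp (rate * \<tau>max) * E"
          unfolding E_def by (simp flip: exp_add)
        then show ?thesis using M by (simp add: R'_def mult_left_mono)
      qed
      finally show ?thesis .
    qed
    obtain \<phi> where \<phi>: "bdot m \<phi> (bapply m T (dev i t)) = V i t"
      "\<And>u. bdot m \<phi> u \<le> bvnorm p m u"
      unfolding V_def using bvnorm_support[OF p, where m=m and v="bapply m T (dev i t)"] by metis
    define q where "q s = bdot m \<phi> (bapply m T (dev i s))" for s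
    obtain X X' z z' where mv:
      "bdot m \<phi> (bapply m T (dev_rhs i t))
       = bdot m \<phi> (bapply m T (bapply m (Adiag \<N> i X z t) (dev i t)))
         + (\<Sum>j\<in>{1..N} - {i}. bdot m \<phi> (bapply m T (bapply m (Aoff \<N> i j X z t) (dev j t))))
         + (\<Sum>j\<in>{1..N}. bdot m \<phi> (bapply m T (bapply m (Bdel \<N> i j X' z' t) (dev j t'))))
         + bdot m \<phi> (bapply m T (\<lambda>k. if k = 0 then w i t else 0))"
      by (rule mean_value[OF i less_imp_le[OF t(1)], of \<phi>, folded t'_def])
    define Dq where "Dq = bdot m \<phi> (bapply m T (dev_rhs i t))"
    have q: "(q has_real_derivative Dq) (at t)"
      unfolding q_def[abs_def] Dq_def by (rule has_real_derivative_bdot_bapply) (rule S(2)[OF i t])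
    have bound: "bdot m \<phi> (bapply m T (bapply m A (dev j s))) \<le> bnorm p m (bconj m T A) * V j s" for A j s
      using support_bnorm[OF p \<phi>(2), of "bconj m T A" "bapply m T (dev j s)"]
      by (simp add: bapply_bconj_Tbar V_def)
    \<comment> \<open>The measure may be negative, so an upper bound on \<open>V i t\<close> would
      not do: the equality \<open>V i t = R\<close> at the crossing is used. The other coefficients
      are norms, for which upper bounds suffice.\<close>
    have "bdot m \<phi> (bapply m T (bapply m (Adiag \<N> i X z t) (dev i t)))
        \<le> bmeasure p m (bconj m T (Adiag \<N> i X z t)) * R"
      using support_bmeasure[OF p \<phi>(1)[unfolded V_def] \<phi>(2), of "bconj m T (Adiag \<N> i X z t)"] Vt
      by (simp add: bapply_bconj_Tbar U R_def E_def flip: V_def)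
    moreover have "(\<Sum>j\<in>{1..N} - {i}. bdot m \<phi> (bapply m T (bapply m (Aoff \<N> i j X z t) (dev j t))))
        \<le> (\<Sum>j\<in>{1..N} - {i}. bnorm p m (bconj m T (Aoff \<N> i j X z t))) * R"
      unfolding sum_distrib_right
      by (intro sum_mono order_trans[OF bound] mult_left_mono bnorm_nonneg p VR) auto
    moreover have "(bmeasure p m (bconj m T (Adiag \<N> i X z t))
        + (\<Sum>j\<in>{1..N} - {i}. bnorm p m (bconj m T (Aoff \<N> i j X z t)))) * R \<le> - \<sigma>hi * R"
      using C2[OF less_imp_le[OF t(1)] i] R0 by (rule mult_right_mono)
    moreover have "(\<Sum>j\<in>{1..N}. bdot m \<phi> (bapply m T (bapply m (Bdel \<N> i j X' z' t) (dev j t'))))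
        \<le> (\<Sum>j\<in>{1..N}. bnorm p m (bconj m T (Bdel \<N> i j X' z' t))) * R'"
      unfolding sum_distrib_right
      by (intro sum_mono order_trans[OF bound] mult_left_mono bnorm_nonneg p VR') auto
    moreover have "(\<Sum>j\<in>{1..N}. bnorm p m (bconj m T (Bdel \<N> i j X' z' t))) * R' \<le> \<sigma>lo * R'"
      using C3[OF less_imp_le[OF t(1)] i] R'0 by (rule mult_right_mono)
    moreover have "bdot m \<phi> (bapply m T (\<lambda>k. if k = 0 then w i t else 0)) \<le> bnorm p m T * W"
    proof -
      have "bdot m \<phi> (bapply m T (\<lambda>k. if k = 0 then w i t else 0)) \<le> bnorm p m T * vnorm p (w i t)"
        using support_bnorm[OF p \<phi>(2), of T "\<lambda>k. if k = 0 then w i t else 0"]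
        unfolding bvnorm_single[OF p le0] .
      also have "\<dots> \<le> bnorm p m T * W"
        using t by (intro mult_left_mono bnorm_nonneg p vnorm_w_le i) auto
      finally show ?thesis .
    qed
    ultimately have "Dq \<le> - \<sigma>hi * R + \<sigma>lo * R' + bnorm p m T * W"
      unfolding Dq_def mv distrib_right by linarith
    \<comment> \<open>The terms in K cancel against the disturbance, and the equation for the rate
      leaves \<open>- rate * M * E\<close>, the derivative of U at t. The surplus from \<epsilon>
      makes the comparison strict.\<close>
    moreover have "- \<sigma>hi * R + \<sigma>lo * R' + bnorm p m T * W = - rate * M * E - (\<sigma>hi - \<sigma>lo) * \<epsilon>"
    proof -
      have "K * (\<sigma>hi - \<sigma>lo) = bnorm p m T * W" using sigma by (simp add: K_def)
      moreover have "\<sigma>lo * exp (rate * \<tau>max) = \<sigma>hi - rate" using rate(2) by linarith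
      then have "\<sigma>lo * (M * (exp (rate * \<tau>max) * E)) = (\<sigma>hi - rate) * (M * E)"
        by (simp add: mult_ac)
      ultimately show ?thesis by (simp add: R_def R'_def algebra_simps)
    qed
    moreover have "0 < (\<sigma>hi - \<sigma>lo) * \<epsilon>" using sigma \<epsilon> by simp
    ultimately have neg: "Dq - - rate * M * E < 0" by linarith
    \<comment> \<open>At t the difference q - U equals \<epsilon> and strictly decreases, so just
      before t it exceeds \<epsilon>, and so does \<open>V i - U\<close>, as V i dominates
      q.\<close>
    have "((\<lambda>s. q s - U s) has_real_derivative (Dq - - rate * M * E)) (at t)"
      unfolding U[abs_def] E_def by (rule derivative_eq_intros q refl | simp)+
    from DERIV_neg_dec_left[OF this neg] obtain d where "d > 0"
      and d: "\<And>h. 0 < h \<Longrightarrow> h < d \<Longrightarrow> q t - U t < q (t - h) - U (t - h)" by blast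
    have "U s + \<epsilon> \<le> V i s" if "t - d < s" "s < t" for s
    proof -
      have "\<epsilon> < q s - U s" using d[of "t - s"] that \<phi>(1) Vt by (simp add: q_def)
      moreover have "q s \<le> V i s" unfolding q_def V_def by (rule \<phi>(2))
      ultimately show ?thesis by linarith
    qed
    then show "\<exists>d>0. \<forall>s. t - d < s \<and> s < t \<longrightarrow> U s + \<epsilon> \<le> V i s" using \<open>d > 0\<close> by blast
  qed (use S(1) assms in auto)
qed

text \<open>The state error is block 0 of the deviation, recovered from T times the deviation at the
  cost of the norm of the inverse; with the factor |T| in U this gives the condition number.\<close>

lemma deviation_bound:
  assumes t: "start \<N> \<le> t"
  shows "(MAX i\<in>{1..N}. vnorm p (x i t - xs i t))
    \<le> bcond p m T / (\<sigma>hi - \<sigma>lo) * W + bcond p m T * exp (- rate * (t - start \<N>)) * (M1 + M2)"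
proof (rule Max.boundedI)
  fix a assume "a \<in> (\<lambda>i. vnorm p (x i t - xs i t)) ` {1..N}"
  then obtain i where i: "i \<in> {1..N}" "a = vnorm p (x i t - xs i t)" by blast
  have "a \<le> bvnorm p m (dev i t)"
    using vnorm_le_bvnorm[OF p, of 0 m "dev i t"] by (simp add: i dev_def)
  also have "\<dots> = bvnorm p m (bapply m (binv m T) (bapply m T (dev i t)))"
    by (intro bvnorm_cong) (simp add: binv_Tbar)
  also have "\<dots> \<le> bnorm p m (binv m T) * V i t" unfolding V_def by (rule bvnorm_bapply_le[OF p])
  also have "\<dots> \<le> bnorm p m (binv m T) * U t"
    by (intro mult_left_mono V_le_U i t bnorm_nonneg p)
  finally show "a \<le> bcond p m T / (\<sigma>hi - \<sigma>lo) * W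
      + bcond p m T * exp (- rate * (t - start \<N>)) * (M1 + M2)"
    by (simp add: U_def bcond_def algebra_simps)
qed (use N in auto)

end

section \<open>Scalability\<close>

lemma class_K_linear: "0 < a \<Longrightarrow> class_K \<infinity> (\<lambda>r. a * r)"
  by (auto simp: class_K_def strict_mono_on_def intro!: continuous_intros)

lemma class_KL_exp:
  assumes "0 < a" "0 < b"
  shows "class_KL \<infinity> (\<lambda>r s. a * exp (- b * s) * r)"
  unfolding class_KL_def
proof (intro conjI allI impI)
  show "continuous_on ({r. 0 \<le> r \<and> ereal r < \<infinity>} \<times> {0..}) (\<lambda>(r, s). a * exp (- b * s) * r)"
    unfolding case_prod_unfold by (intro continuous_intros)
  show "class_K \<infinity> (\<lambda>r. a * exp (- b * s) * r)" for s
    using assms by (intro class_K_linear) simp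
  fix r :: real assume r: "0 \<le> r \<and> ereal r < \<infinity>"
  show "antimono_on {0..} (\<lambda>s. a * exp (- b * s) * r)"
    using assms r by (intro monotone_onI mult_right_mono mult_left_mono) auto
  have "filterlim (\<lambda>s. - b * s) at_bot at_top"
    using assms(2) by (intro filterlim_tendsto_neg_mult_at_bot[OF tendsto_const _ filterlim_ident]) simp
  then have "((\<lambda>s. exp (- b * s)) \<longlongrightarrow> 0) at_top"
    by (rule filterlim_compose[OF exp_at_bot])
  then show "((\<lambda>s. a * exp (- b * s) * r) \<longlongrightarrow> 0) at_top"
    using tendsto_mult[OF tendsto_mult[OF tendsto_const] tendsto_const] by force
qed

text \<open>Unique existence of the rate is part of the conclusion, so that the bound stated for
  every such rate is not vacuous.\<close>

theorem proposition1:
  fixes net :: "nat \<Rightarrow> ('n::finite) network"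
    and xs :: "nat \<Rightarrow> nat \<Rightarrow> real \<Rightarrow> real^'n"
    and \<alpha> :: "nat \<Rightarrow> real"
    and p :: ereal
    and m nbound :: nat
    and \<tau>max \<sigma>lo \<sigma>hi :: real
  assumes p: "1 \<le> p"
    and m: "1 \<le> m"
    and network: "\<And>N. N \<ge> 2 \<Longrightarrow> multiplex_network m nbound \<tau>max N (net N)"
    and outputs: "\<And>N i y. N \<ge> 2 \<Longrightarrow> i \<in> {1..N} \<Longrightarrow> outmap (net N) i y = y"
    and desired: "\<And>N. N \<ge> 2 \<Longrightarrow> desired_solution \<tau>max N (net N) (xs N)"
    and sigma: "0 \<le> \<sigma>lo" "\<sigma>lo < \<sigma>hi"
    and C1: "\<And>N t i k. N \<ge> 2 \<Longrightarrow> t \<ge> start (net N) \<Longrightarrow> i \<in> {1..N} \<Longrightarrow> k \<le> m \<Longrightarrow>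
        coupl_at (net N) i k (xs N) t = 0 \<and> dcoupl_at (net N) i k (xs N) t = 0"
    and C2: "\<And>N t i x z. N \<ge> 2 \<Longrightarrow> t \<ge> start (net N) \<Longrightarrow> i \<in> {1..N} \<Longrightarrow>
        bmeasure p m (bconj m (Tbar \<alpha>) (Adiag (net N) i x z t))
          + (\<Sum>j\<in>{1..N} - {i}. bnorm p m (bconj m (Tbar \<alpha>) (Aoff (net N) i j x z t))) \<le> - \<sigma>hi"
    and C3: "\<And>N t i x z. N \<ge> 2 \<Longrightarrow> t \<ge> start (net N) \<Longrightarrow> i \<in> {1..N} \<Longrightarrow>
        (\<Sum>j\<in>{1..N}. bnorm p m (bconj m (Tbar \<alpha>) (Bdel (net N) i j x z t))) \<le> \<sigma>lo"
  shows "input_to_state_scalable p m \<tau>max net xs \<and>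
    (\<exists>!rate. rate > 0 \<and> rate - \<sigma>hi + \<sigma>lo * exp (rate * \<tau>max) = 0) \<and>
    (\<forall>rate. rate > 0 \<and> rate - \<sigma>hi + \<sigma>lo * exp (rate * \<tau>max) = 0 \<longrightarrow>
      (\<forall>N\<ge>2. \<forall>w c x r. disturbance N (net N) w \<longrightarrow> closed_loop m \<tau>max N (net N) w c x r \<longrightarrow>
        (\<forall>t\<ge>start (net N).
          (MAX i\<in>{1..N}. vnorm p (x i t - xs N i t))
          \<le> bcond p m (Tbar \<alpha> :: 'n bmat) / (\<sigma>hi - \<sigma>lo)
              * (MAX i\<in>{1..N}. Linf p (start (net N)) (w i))
            + bcond p m (Tbar \<alpha> :: 'n bmat) * exp (- rate * (t - start (net N)))
              * ((MAX i\<in>{1..N}. SUP s\<in>{start (net N) - \<tau>max..start (net N)}.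
                    vnorm p (x i s - xs N i s))
                 + (MAX i\<in>{1..N}. SUP s\<in>{start (net N) - \<tau>max..start (net N)}.
                    \<Sum>k=1..m. vnorm p (r i k s +
                      (\<Sum>b=0..m-k. (fact (m - 1 - b) / fact (m - k - b) * s ^ (m - k - b))
                         *\<^sub>R c i (m - 1 - b))))))))"
proof -
  \<comment> \<open>Nonnegativity of \<tau>max is read off from the delay of one network, here with
    N = 2.\<close>
  have delay: "0 \<le> delay (net 2) (start (net 2)) \<and> delay (net 2) (start (net 2)) \<le> \<tau>max"
    using network[of 2] unfolding multiplex_network_def by blast
  have "\<exists>!rate. rate > 0 \<and> rate - \<sigma>hi + \<sigma>lo * exp (rate * \<tau>max) = 0"
    using delay by (intro Halanay_rate sigma) linarith
  moreover have bound: "(MAX i\<in>{1..N}. vnorm p (x i t - xs N i t))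
      \<le> bcond p m (Tbar \<alpha> :: 'n bmat) / (\<sigma>hi - \<sigma>lo) * (MAX i\<in>{1..N}. Linf p (start (net N)) (w i))
        + bcond p m (Tbar \<alpha> :: 'n bmat) * exp (- rate * (t - start (net N)))
          * ((MAX i\<in>{1..N}. SUP s\<in>{start (net N) - \<tau>max..start (net N)}. vnorm p (x i s - xs N i s))
             + (MAX i\<in>{1..N}. SUP s\<in>{start (net N) - \<tau>max..start (net N)}.
                  \<Sum>k=1..m. vnorm p (r i k s + dpoly m (k - 1) (c i) s)))"
    if "rate > 0 \<and> rate - \<sigma>hi + \<sigma>lo * exp (rate * \<tau>max) = 0" "N \<ge> 2" "disturbance N (net N) w"
      "closed_loop m \<tau>max N (net N) w c x r" "t \<ge> start (net N)" for rate N w c x r t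
  proof -
    interpret perturbed_network "net N" p m nbound N \<tau>max \<sigma>lo \<sigma>hi rate \<alpha> "xs N" x w c r
      using that network desired C1 C2 C3 p m sigma by unfold_locales auto
    show ?thesis using deviation_bound[OF that(5)] unfolding W_def M1_def M2_def .
  qed
  ultimately obtain rate where rate: "rate > 0 \<and> rate - \<sigma>hi + \<sigma>lo * exp (rate * \<tau>max) = 0" by blast
  let ?\<kappa> = "bcond p m (Tbar \<alpha> :: 'n bmat)"
  have \<kappa>: "0 < ?\<kappa>" by (rule bcond_Tbar_pos[OF p])
  have "input_to_state_scalable p m \<tau>max net xs"
    unfolding input_to_state_scalable_def
  proof (intro exI conjI allI impI)
    \<comment> \<open>The bound is linear in both initial terms with the same coefficient, so one
      function serves as both KL gains.\<close>
    show "class_KL \<infinity> (\<lambda>r s. ?\<kappa> * exp (- rate * s) * r)" by (rule class_KL_exp) (use \<kappa> rate in auto)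
    then show "class_KL \<infinity> (\<lambda>r s. ?\<kappa> * exp (- rate * s) * r)" .
    show "class_K \<infinity> (\<lambda>r. ?\<kappa> / (\<sigma>hi - \<sigma>lo) * r)" by (rule class_K_linear) (use \<kappa> sigma in simp)
  next
    fix N w c x r t
    assume "N \<ge> 2" "disturbance N (net N) w" "closed_loop m \<tau>max N (net N) w c x r" "t \<ge> start (net N)"
    from bound[OF rate this]
    show "(MAX i\<in>{1..N}. vnorm p (x i t - xs N i t))
        \<le> ?\<kappa> / (\<sigma>hi - \<sigma>lo) * (MAX i\<in>{1..N}. Linf p (start (net N)) (w i))
          + ?\<kappa> * exp (- rate * (t - start (net N)))
            * (MAX i\<in>{1..N}. SUP s\<in>{start (net N) - \<tau>max..start (net N)}. vnorm p (x i s - xs N i s))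
          + ?\<kappa> * exp (- rate * (t - start (net N)))
            * (MAX i\<in>{1..N}. SUP s\<in>{start (net N) - \<tau>max..start (net N)}.
                \<Sum>k=1..m. vnorm p (r i k s + dbar_deriv m (k - 1) (c i) s))"
      by (simp only: dbar_deriv_eq distrib_left add.assoc)
  qed
  moreover have "(\<Sum>k=1..m. vnorm p (r i k s + (\<Sum>b=0..m-k. (fact (m - 1 - b) / fact (m - k - b) * s ^ (m - k - b))
        *\<^sub>R c i (m - 1 - b))))
      = (\<Sum>k=1..m. vnorm p (r i k s + dpoly m (k - 1) (c i) s))"
    for r :: "nat \<Rightarrow> nat \<Rightarrow> real \<Rightarrow> real^'n" and c :: "nat \<Rightarrow> nat \<Rightarrow> real^'n" and i s
    by (intro sum.cong refl) (simp only: dpoly_explicit atLeastAtMost_iff)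
  ultimately show ?thesis
    using \<open>\<exists>!rate. rate > 0 \<and> rate - \<sigma>hi + \<sigma>lo * exp (rate * \<tau>max) = 0\<close> bound by (simp only: simp_thms) blast
qed

end
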